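(* Let $G$ be an amenable (discrete) group that has a locally invariant order. Then $G$ is left-orderable. Consequently, $G$ is locally indicable.
   Context: A partial order on a group $G$ is a transitive, irreflexive binary relation $\prec$ on $G$; we write $x \succ y$ for $y \prec x$. A partial order $\prec$ on $G$ is a total order if for all $x \neq y$ in $G$ either $x \prec y$ or $x \succ y$. A locally invariant order on $G$ is a partial order $\prec$ on $G$ such that, for all $x, y \in G$ with $y \neq e$, either $xy \succ x$ or $xy^{-1} \succ x$. An order $\prec$ on $G$ is left-invariant if $x \prec y$ implies $gx \prec gy$ for all $x,y,g \in G$. $G$ is left-orderable if there exists a left-invariant total order on $G$. $G$ is locally indicable if every nontrivial finitely generated subgroup of $G$ has an infinite cyclic quotient. A (discrete) group $G$ is amenable if for every continuous action of $G$ on a (nonempty) compact Hausdorff space $X$ there is a $G$-invariant probability measure on $X$ (or any equivalent standard definition). *)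

theory Defs
  imports "HOL-Algebra.Algebra"
begin

text \<open>
  An order on a group \<open>G\<close> is a strict relation \<open>r\<close>, with \<open>r x y\<close> read as \<open>x \<prec> y\<close>;
  only its restriction to \<open>carrier G\<close> matters.
\<close>

definition partial_order_of :: "('a, 'b) monoid_scheme \<Rightarrow> ('a \<Rightarrow> 'a \<Rightarrow> bool) \<Rightarrow> bool"
  where "partial_order_of G r \<longleftrightarrow> transp_on (carrier G) r \<and> irreflp_on (carrier G) r"

definition total_order_of :: "('a, 'b) monoid_scheme \<Rightarrow> ('a \<Rightarrow> 'a \<Rightarrow> bool) \<Rightarrow> bool"
  where "total_order_of G r \<longleftrightarrow> partial_order_of G r \<and> totalp_on (carrier G) r"

definition locally_invariant_order :: "('a, 'b) monoid_scheme \<Rightarrow> ('a \<Rightarrow> 'a \<Rightarrow> bool) \<Rightarrow> bool"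
  where "locally_invariant_order G r \<longleftrightarrow>
    partial_order_of G r \<and>
    (\<forall>x\<in>carrier G. \<forall>y\<in>carrier G. y \<noteq> \<one>\<^bsub>G\<^esub> \<longrightarrow>
       r x (x \<otimes>\<^bsub>G\<^esub> y) \<or> r x (x \<otimes>\<^bsub>G\<^esub> inv\<^bsub>G\<^esub> y))"

definition left_invariant :: "('a, 'b) monoid_scheme \<Rightarrow> ('a \<Rightarrow> 'a \<Rightarrow> bool) \<Rightarrow> bool"
  where "left_invariant G r \<longleftrightarrow>
    (\<forall>x\<in>carrier G. \<forall>y\<in>carrier G. \<forall>g\<in>carrier G. r x y \<longrightarrow> r (g \<otimes>\<^bsub>G\<^esub> x) (g \<otimes>\<^bsub>G\<^esub> y))"

definition left_orderable :: "('a, 'b) monoid_scheme \<Rightarrow> bool"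
  where "left_orderable G \<longleftrightarrow> (\<exists>r. total_order_of G r \<and> left_invariant G r)"

definition locally_indicable :: "('a, 'b) monoid_scheme \<Rightarrow> bool"
  where "locally_indicable G \<longleftrightarrow>
    (\<forall>S. finite S \<longrightarrow> S \<subseteq> carrier G \<longrightarrow> \<not> trivial_group (subgroup_generated G S) \<longrightarrow>
      (\<exists>N. N \<lhd> subgroup_generated G S \<and>
           cyclic_group (subgroup_generated G S Mod N) \<and>
           infinite (carrier (subgroup_generated G S Mod N))))"

text \<open>
  Amenability of a discrete group in von Neumann's form: there is a left-invariant, finitely
  additive probability measure defined on all subsets of the group. The fixed-point form, an
  invariant probability measure for every continuous action on a nonempty compact Hausdorff
  space, ranges over spaces of arbitrary type and so is not a HOL formula.
\<close>

definition amenable :: "('a, 'b) monoid_scheme \<Rightarrow> bool"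
  where "amenable G \<longleftrightarrow>
    (\<exists>\<mu> :: 'a set \<Rightarrow> real.
       \<mu> (carrier G) = 1 \<and>
       (\<forall>A. A \<subseteq> carrier G \<longrightarrow> 0 \<le> \<mu> A) \<and>
       (\<forall>A B. A \<subseteq> carrier G \<longrightarrow> B \<subseteq> carrier G \<longrightarrow> A \<inter> B = {} \<longrightarrow> \<mu> (A \<union> B) = \<mu> A + \<mu> B) \<and>
       (\<forall>g\<in>carrier G. \<forall>A. A \<subseteq> carrier G \<longrightarrow> \<mu> (g <#\<^bsub>G\<^esub> A) = \<mu> A))"

end

theory Submission
  imports Defs
begin

text \<open>
  Let \<open>\<mu>\<close> be an invariant mean on \<open>G\<close>. If the translates of a set by the positive powers of some
  group element never meet it again, its mean is \<open>0\<close>; this finitely additive form of Poincare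
  recurrence replaces an invariant measure on a space of orders. An ultrafilter containing all
  sets of mean \<open>1\<close> then gives limits of translates of an order in which every configuration that
  cannot recur is absent.

  For a locally invariant order the configurations excluded are the local minima of a coset of a
  cyclic group and the failures of \<open>y \<succ> 1, z \<succ> 1 \<Longrightarrow> y z \<succ> 1\<close>, so the limit has a total positive
  cone, and \<open>G\<close> is left-orderable. A second limit, of the conjugates of a left order, satisfies the
  Conrad inequality \<open>f g\<^sup>2 \<succ> g\<close> for \<open>f, g \<succ> 1\<close>.

  The Conrad inequality implies \<open>f g\<^bsup>p+1\<^esup> \<succ> g\<^bsup>p\<^esup>\<close> for all integers \<open>p\<close>. Hence, if \<open>m\<close> is the greatest of
  finitely many generators and their inverses, multiplication by any \<open>h\<close> in the generated subgroup
  moves the integer part of \<open>x\<close> relative to the powers of \<open>m\<close> by an amount bounded independently of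
  \<open>x\<close>. The mean of this displacement is a homomorphism to the reals that takes \<open>m\<close> to \<open>1\<close>, and a
  rational-linear functional followed by clearing denominators makes it integer-valued.
\<close>

no_notation lesspoll (infixl \<open>\<prec>\<close> 50)

section \<open>Invariant means and recurrence\<close>

text \<open>Zorn's lemma, applied to the nontrivial filters below \<open>F\<close>: the infimum of a
  nonempty chain stays nontrivial because its events are those of its members. A minimal filter
  \<open>U\<close> decides every \<open>P\<close>, since its meet with the principal filter of
  \<open>P\<close> is either trivial or \<open>U\<close> itself.\<close>

lemma ultrafilter_exists:
  fixes F :: "'a filter"
  assumes "F \<noteq> bot"
  shows "\<exists>U\<le>F. U \<noteq> bot \<and> (\<forall>P. eventually P U \<or> eventually (\<lambda>x. \<not> P x) U)"
proof -
  define \<F> where "\<F> = {U. U \<noteq> bot \<and> U \<le> F}"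
  have "\<exists>U\<in>\<F>. \<forall>V\<in>\<F>. V \<le> U \<longrightarrow> V = U"
  proof (rule predicate_Zorn)
    show "partial_order_on \<F> (relation_of (\<lambda>U V. V \<le> U) \<F>)"
      by (rule partial_order_on_relation_ofI) auto
  next
    fix C assume C: "C \<in> Chains (relation_of (\<lambda>U V. V \<le> U) \<F>)"
    then have CF: "C \<subseteq> \<F>" and lin: "\<And>U V. U \<in> C \<Longrightarrow> V \<in> C \<Longrightarrow> U \<le> V \<or> V \<le> U"
      by (auto simp: Chains_def relation_of_def)
    show "\<exists>U\<in>\<F>. \<forall>V\<in>C. U \<le> V"
    proof (cases "C = {}")
      case True
      then show ?thesis using assms by (auto simp: \<F>_def)
    next
      case False
      have "eventually P (Inf C) \<longleftrightarrow> (\<exists>U\<in>C. eventually P U)" for P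
      proof (rule eventually_Inf_base[OF False])
        fix U V assume "U \<in> C" "V \<in> C"
        then show "\<exists>W\<in>C. W \<le> inf U V"
          using lin[of U V] by (metis inf_greatest order_refl)
      qed
      then have "Inf C \<noteq> bot"
        using CF by (auto simp: trivial_limit_def \<F>_def)
      moreover have "Inf C \<le> F"
      proof -
        obtain V where V: "V \<in> C" using False by blast
        then have "V \<le> F" using CF by (auto simp: \<F>_def)
        with V show ?thesis by (rule Inf_lower2)
      qed
      ultimately show ?thesis by (intro bexI[of _ "Inf C"]) (auto simp: \<F>_def Inf_lower)
    qed
  qed
  then obtain U where "U \<in> \<F>" and max: "\<And>V. V \<in> \<F> \<Longrightarrow> V \<le> U \<Longrightarrow> V = U" by blast
  then have U: "U \<noteq> bot" "U \<le> F" by (simp_all add: \<F>_def)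
  have min: "V = U" if "V \<noteq> bot" "V \<le> U" for V
    using that order_trans[OF that(2) U(2)] by (intro max) (simp_all add: \<F>_def)
  have "eventually P U \<or> eventually (\<lambda>x. \<not> P x) U" for P
  proof (cases "inf U (principal {x. P x}) = bot")
    case True
    then show ?thesis by (simp add: trivial_limit_def eventually_inf_principal)
  next
    case False
    then have "inf U (principal {x. P x}) = U" by (intro min) auto
    then have "U \<le> principal {x. P x}" by (simp add: inf.absorb_iff1)
    then show ?thesis by (simp add: le_principal)
  qed
  with U show ?thesis by (intro exI[of _ U] conjI allI)
qed

locale mean_group = group G for G (structure) +
  fixes \<mu> :: "'a set \<Rightarrow> real"
  assumes mean_carrier: "\<mu> (carrier G) = 1"
    and mean_nonneg: "A \<subseteq> carrier G \<Longrightarrow> 0 \<le> \<mu> A"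
    and mean_Un: "A \<subseteq> carrier G \<Longrightarrow> B \<subseteq> carrier G \<Longrightarrow> A \<inter> B = {} \<Longrightarrow> \<mu> (A \<union> B) = \<mu> A + \<mu> B"
    and mean_l_coset: "g \<in> carrier G \<Longrightarrow> A \<subseteq> carrier G \<Longrightarrow> \<mu> (g <#\<^bsub>G\<^esub> A) = \<mu> A"
begin

lemma mean_empty [simp]: "\<mu> {} = 0"
  using mean_Un[of "{}" "{}"] by simp

lemma mean_mono:
  assumes "A \<subseteq> B" "B \<subseteq> carrier G"
  shows "\<mu> A \<le> \<mu> B"
proof -
  have "A \<union> (B - A) = B" using assms(1) by blast
  moreover have "A \<subseteq> carrier G" "B - A \<subseteq> carrier G" using assms by blast+
  ultimately have "\<mu> B = \<mu> A + \<mu> (B - A)"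
    using mean_Un[of A "B - A"] by (metis Diff_disjoint)
  then show ?thesis using mean_nonneg[of "B - A"] assms by (simp add: subset_iff)
qed

lemma mean_UN:
  assumes "finite I" "\<And>i. i \<in> I \<Longrightarrow> A i \<subseteq> carrier G" "disjoint_family_on A I"
  shows "\<mu> (\<Union>i\<in>I. A i) = (\<Sum>i\<in>I. \<mu> (A i))"
  using assms
proof (induction I rule: finite_induct)
  case (insert i I)
  have disj: "A i \<inter> (\<Union>j\<in>I. A j) = {}" "disjoint_family_on A I"
    using insert.prems(2) insert.hyps(2) by (simp_all add: disjoint_family_on_insert)
  have sub: "A i \<subseteq> carrier G" "(\<Union>j\<in>I. A j) \<subseteq> carrier G"
    using insert.prems(1) by blast+
  have "\<mu> (\<Union>j\<in>I. A j) = (\<Sum>j\<in>I. \<mu> (A j))"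
    by (rule insert.IH[OF insert.prems(1) disj(2)]) simp
  then show ?case
    using insert.hyps mean_Un[OF sub disj(1)] by simp
qed simp

lemma mean_null_Un:
  assumes "A \<subseteq> carrier G" "B \<subseteq> carrier G" "\<mu> A = 0" "\<mu> B = 0"
  shows "\<mu> (A \<union> B) = 0"
proof -
  have "\<mu> (A \<union> B) = \<mu> A + \<mu> (B - A)"
    using mean_Un[of A "B - A"] assms by (metis Diff_disjoint Diff_subset Un_Diff_cancel order_trans)
  moreover have "\<mu> (B - A) \<le> \<mu> B" using assms by (intro mean_mono) auto
  ultimately show ?thesis using mean_nonneg[of "B - A"] assms by (simp add: subset_iff)
qed

text \<open>The translates of \<open>B\<close> by the powers of \<open>g\<close> are pairwise
  disjoint and have equal mean, so \<open>N\<close> of them have total mean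
  \<open>N * \<mu> B\<close>, which is at most 1 for every \<open>N\<close>.\<close>

lemma wandering_null:
  assumes B: "B \<subseteq> carrier G" and g: "g \<in> carrier G"
    and wandering: "\<And>b n. b \<in> B \<Longrightarrow> (0::nat) < n \<Longrightarrow> g [^] n \<otimes> b \<notin> B"
  shows "\<mu> B = 0"
proof -
  let ?T = "\<lambda>n::nat. g [^] n <#\<^bsub>G\<^esub> B"
  have disj: "?T k \<inter> ?T n = {}" if "k < n" for k n
  proof (rule ccontr)
    assume "?T k \<inter> ?T n \<noteq> {}"
    then obtain b b' where b: "b \<in> B" "b' \<in> B" and eq: "g [^] k \<otimes> b = g [^] n \<otimes> b'"
      by (auto simp: l_coset_def)
    have "g [^] n = g [^] k \<otimes> g [^] (n - k)"
      using g that by (simp add: nat_pow_mult)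
    then have "b = g [^] (n - k) \<otimes> b'"
      using eq subsetD[OF B b(1)] subsetD[OF B b(2)] g by (simp add: m_assoc)
    then show False using wandering[OF b(2), of "n - k"] b(1) that by simp
  qed
  have "real N * \<mu> B \<le> 1" for N
  proof -
    have sub: "?T n \<subseteq> carrier G" for n
      using B g by (simp add: l_coset_subset_G)
    have "disjoint_family_on ?T {..<N}"
      unfolding disjoint_family_on_def
    proof (intro ballI impI)
      fix k n :: nat assume "k \<noteq> n"
      then show "?T k \<inter> ?T n = {}"
        using disj[of k n] disj[of n k] by (cases "k < n") (simp_all add: Int_commute)
    qed
    then have "\<mu> (\<Union>n\<in>{..<N}. ?T n) = real N * \<mu> B"
      using sub B g by (subst mean_UN) (auto simp: mean_l_coset)
    moreover have "\<mu> (\<Union>n\<in>{..<N}. ?T n) \<le> 1"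
      using mean_mono[OF UN_least[OF sub] order_refl] by (simp add: mean_carrier)
    ultimately show ?thesis by simp
  qed
  then have "\<not> 0 < \<mu> B"
    using reals_Archimedean3[of "\<mu> B"] by (meson not_less)
  then show ?thesis using mean_nonneg[OF B] by simp
qed

text \<open>The predicates that hold outside a null set form a nontrivial filter, and
  \<open>U\<close> is an ultrafilter below it. In the last property \<open>P\<close> describes a
  configuration seen at \<open>a\<close>; if it never recurs along the powers of a single
  \<open>g\<close>, it is absent for \<open>U\<close>-almost every \<open>a\<close>.\<close>

lemma wandering_ultrafilter_left:
  obtains U where "U \<noteq> bot" and "\<And>P. eventually P U \<or> eventually (\<lambda>x. \<not> P x) U"
    and "eventually (\<lambda>a. a \<in> carrier G) U"
    and "\<And>P g. \<lbrakk>g \<in> carrier G; \<And>a n. \<lbrakk>a \<in> carrier G; (0::nat) < n; P a; P (g [^] n \<otimes> a)\<rbrakk> \<Longrightarrow> False\<rbrakk>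
      \<Longrightarrow> eventually (\<lambda>a. \<not> P a) U"
proof -
  define F where "F = Abs_filter (\<lambda>P. \<mu> {a \<in> carrier G. \<not> P a} = 0)"
  have F: "eventually P F \<longleftrightarrow> \<mu> {a \<in> carrier G. \<not> P a} = 0" for P
    unfolding F_def
  proof (rule eventually_Abs_filter, standard)
    fix P Q assume "\<mu> {a \<in> carrier G. \<not> P a} = 0" "\<mu> {a \<in> carrier G. \<not> Q a} = 0"
    then have "\<mu> ({a \<in> carrier G. \<not> P a} \<union> {a \<in> carrier G. \<not> Q a}) = 0"
      by (intro mean_null_Un) auto
    then show "\<mu> {a \<in> carrier G. \<not> (P a \<and> Q a)} = 0"
      by (rule back_subst[of "\<lambda>A. \<mu> A = 0"]) auto
  next
    fix P Q :: "'a \<Rightarrow> bool"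
    assume "\<forall>x. P x \<longrightarrow> Q x" "\<mu> {a \<in> carrier G. \<not> P a} = 0"
    then show "\<mu> {a \<in> carrier G. \<not> Q a} = 0"
      using mean_mono[of "{a \<in> carrier G. \<not> Q a}" "{a \<in> carrier G. \<not> P a}"]
        mean_nonneg[of "{a \<in> carrier G. \<not> Q a}"] by fastforce
  qed simp
  have "F \<noteq> bot" by (simp add: trivial_limit_def F mean_carrier)
  then obtain U where U: "U \<le> F" "U \<noteq> bot" "\<And>P. eventually P U \<or> eventually (\<lambda>x. \<not> P x) U"
    using ultrafilter_exists by blast
  show thesis
  proof (rule that[of U])
    show "eventually (\<lambda>a. a \<in> carrier G) U"
      by (rule filter_leD[OF U(1)]) (simp add: F)
  next
    fix P g
    assume "g \<in> carrier G"
      and *: "\<And>a n. \<lbrakk>a \<in> carrier G; (0::nat) < n; P a; P (g [^] n \<otimes> a)\<rbrakk> \<Longrightarrow> False"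
    then have "\<mu> {a \<in> carrier G. P a} = 0"
    proof (intro wandering_null[of _ g])
      fix a and n :: nat assume "a \<in> {a \<in> carrier G. P a}" "0 < n"
      then show "g [^] n \<otimes> a \<notin> {a \<in> carrier G. P a}" using *[of a n] by blast
    qed simp_all
    then show "eventually (\<lambda>a. \<not> P a) U"
      by (intro filter_leD[OF U(1)]) (simp add: F)
  qed (rule U)+
qed

text \<open>The mean is invariant on the left only. Taking the image of the previous ultrafilter
  under inversion exchanges left translation by \<open>inv g [^] n\<close> with right translation by
  \<open>g [^] n\<close>.\<close>

lemma wandering_ultrafilter_right:
  obtains U where "U \<noteq> bot" and "\<And>P. eventually P U \<or> eventually (\<lambda>x. \<not> P x) U"
    and "eventually (\<lambda>a. a \<in> carrier G) U"
    and "\<And>P g. \<lbrakk>g \<in> carrier G; \<And>a n. \<lbrakk>a \<in> carrier G; (0::nat) < n; P a; P (a \<otimes> g [^] n)\<rbrakk> \<Longrightarrow> False\<rbrakk>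
      \<Longrightarrow> eventually (\<lambda>a. \<not> P a) U"
proof (rule wandering_ultrafilter_left)
  fix U
  assume U: "U \<noteq> bot" "\<And>P. eventually P U \<or> eventually (\<lambda>x. \<not> P x) U"
    "eventually (\<lambda>a. a \<in> carrier G) U"
    and wandering: "\<And>P g. \<lbrakk>g \<in> carrier G; \<And>a n. \<lbrakk>a \<in> carrier G; (0::nat) < n; P a; P (g [^] n \<otimes> a)\<rbrakk> \<Longrightarrow> False\<rbrakk>
      \<Longrightarrow> eventually (\<lambda>a. \<not> P a) U"
  show thesis
  proof (rule that[of "filtermap (m_inv G) U"])
    show "eventually P (filtermap (m_inv G) U) \<or> eventually (\<lambda>x. \<not> P x) (filtermap (m_inv G) U)" for P
      unfolding eventually_filtermap by (rule U(2))
    show "eventually (\<lambda>a. a \<in> carrier G) (filtermap (m_inv G) U)"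
      unfolding eventually_filtermap using U(3) by (rule eventually_mono) simp
  next
    fix P g
    assume g: "g \<in> carrier G"
      and *: "\<And>a n. \<lbrakk>a \<in> carrier G; (0::nat) < n; P a; P (a \<otimes> g [^] n)\<rbrakk> \<Longrightarrow> False"
    show "eventually (\<lambda>a. \<not> P a) (filtermap (m_inv G) U)"
      unfolding eventually_filtermap
    proof (rule wandering[of "inv g"])
      fix a and n :: nat
      assume a: "a \<in> carrier G" "0 < n" "P (inv a)" "P (inv (inv g [^] n \<otimes> a))"
      have "inv (inv g [^] n \<otimes> a) = inv a \<otimes> g [^] n"
        using a(1) g by (simp add: inv_mult_group nat_pow_inv)
      with a show False using *[of "inv a" n] by simp
    qed (use g in simp)
  qed (simp add: filtermap_bot_iff U(1))
qed

section \<open>Averages of integer-valued functions with finite range\<close>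

lemma sum_level_sets:
  fixes v :: "'c \<Rightarrow> int"
  assumes fin: "finite (t ` carrier G)"
  shows "(\<Sum>k\<in>(\<lambda>g. v (t g)) ` carrier G. of_int k * \<mu> {g \<in> carrier G. v (t g) = k})
       = (\<Sum>x\<in>t ` carrier G. of_int (v x) * \<mu> {g \<in> carrier G. t g = x})"
proof -
  \<comment> \<open>Each level set of \<open>v\<close> after \<open>t\<close> is a disjoint union of
    finitely many level sets of \<open>t\<close>, so both sides integrate the same function, once
    over a coarser and once over a finer partition.\<close>
  let ?T = "t ` carrier G"
  have "(\<Sum>x\<in>?T. of_int (v x) * \<mu> {g \<in> carrier G. t g = x})
      = (\<Sum>k\<in>v ` ?T. \<Sum>x\<in>{x\<in>?T. v x = k}. of_int (v x) * \<mu> {g \<in> carrier G. t g = x})"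
    by (rule sum.image_gen[OF fin])
  also have "\<dots> = (\<Sum>k\<in>v ` ?T. of_int k * \<mu> {g \<in> carrier G. v (t g) = k})"
  proof (rule sum.cong[OF refl])
    fix k
    have "{g \<in> carrier G. v (t g) = k} = (\<Union>x\<in>{x\<in>?T. v x = k}. {g \<in> carrier G. t g = x})"
      by auto
    moreover have "disjoint_family_on (\<lambda>x. {g \<in> carrier G. t g = x}) {x\<in>?T. v x = k}"
      by (auto simp: disjoint_family_on_def)
    ultimately have "\<mu> {g \<in> carrier G. v (t g) = k}
        = (\<Sum>x\<in>{x\<in>?T. v x = k}. \<mu> {g \<in> carrier G. t g = x})"
      using mean_UN[of "{x\<in>?T. v x = k}" "\<lambda>x. {g \<in> carrier G. t g = x}"] fin by simp
    then show "(\<Sum>x\<in>{x\<in>?T. v x = k}. of_int (v x) * \<mu> {g \<in> carrier G. t g = x})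
        = of_int k * \<mu> {g \<in> carrier G. v (t g) = k}"
      by (simp add: sum_distrib_left)
  qed
  finally show ?thesis by (simp add: image_image)
qed

text \<open>The integral of \<open>f\<close> against \<open>\<mu>\<close>, faithful only for
  \<open>f\<close> with finite range: a sum over an infinite image is 0 by convention.\<close>

definition average :: "('a \<Rightarrow> int) \<Rightarrow> real"
  where "average f = (\<Sum>k\<in>f ` carrier G. of_int k * \<mu> {g \<in> carrier G. f g = k})"

lemma average_cong:
  assumes "\<And>g. g \<in> carrier G \<Longrightarrow> f g = f' g"
  shows "average f = average f'"
proof -
  have "f ` carrier G = f' ` carrier G"
    using assms by (rule image_cong[OF refl])
  moreover have "{g \<in> carrier G. f g = k} = {g \<in> carrier G. f' g = k}" for k
    using assms by (metis (mono_tags, lifting))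
  ultimately show ?thesis by (simp only: average_def)
qed

lemma average_const [simp]: "average (\<lambda>g. k) = of_int k"
proof -
  have "(\<lambda>g::'a. k) ` carrier G = {k}" using one_closed by blast
  then show ?thesis by (simp add: average_def mean_carrier)
qed

lemma average_add:
  assumes "finite (f ` carrier G)" "finite (f' ` carrier G)"
  shows "average (\<lambda>g. f g + f' g) = average f + average f'"
proof -
  let ?t = "\<lambda>g. (f g, f' g)"
  have "finite (?t ` carrier G)"
    by (rule finite_subset[of _ "f ` carrier G \<times> f' ` carrier G"]) (use assms in auto)
  \<comment> \<open>The level sets of the pair form one partition that is fine enough for both
    summands and for their sum, which reduces additivity to that of finite sums.\<close>
  note eq = sum_level_sets[OF this, folded average_def]
  show ?thesis
    using eq[of fst] eq[of snd] eq[of "\<lambda>x. fst x + snd x"]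
    by (simp add: sum.distrib distrib_right)
qed

lemma average_translate:
  assumes h: "h \<in> carrier G"
  shows "average (\<lambda>g. f (h \<otimes> g)) = average f"
proof -
  have surj: "(\<lambda>g. h \<otimes> g) ` carrier G = carrier G"
    using h surj_const_mult by simp
  have "\<mu> {g \<in> carrier G. f (h \<otimes> g) = k} = \<mu> {g \<in> carrier G. f g = k}" for k
  proof -
    have "h <#\<^bsub>G\<^esub> {g \<in> carrier G. f (h \<otimes> g) = k} = {g \<in> carrier G. f g = k}"
    proof (intro equalityI subsetI)
      fix x assume "x \<in> {g \<in> carrier G. f g = k}"
      then have x: "x \<in> carrier G" "f x = k" by simp_all
      then have "h \<otimes> (inv h \<otimes> x) = x" using h by (simp add: m_assoc[symmetric])
      then show "x \<in> h <#\<^bsub>G\<^esub> {g \<in> carrier G. f (h \<otimes> g) = k}"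
        using x h unfolding l_coset_def by (intro UN_I[of "inv h \<otimes> x"]) simp_all
    qed (use h in \<open>auto simp: l_coset_def\<close>)
    then show ?thesis
      using mean_l_coset[OF h, of "{g \<in> carrier G. f (h \<otimes> g) = k}"] by simp
  qed
  moreover have "(\<lambda>g. f (h \<otimes> g)) ` carrier G = f ` carrier G"
    using arg_cong[OF surj, of "\<lambda>A. f ` A"] by (simp only: image_image)
  ultimately show ?thesis by (simp only: average_def)
qed

text \<open>The subgroup \<open>H\<close> carries no mean of its own here: \<open>p\<close> is spread over \<open>G\<close> along a
  transversal of the right cosets of \<open>H\<close>, on which \<open>H\<close> acts from the left.\<close>

lemma average_displacement_hom:
  fixes p :: "'a \<Rightarrow> int"
  assumes H: "subgroup H G"
    and bounded: "\<And>h. h \<in> H \<Longrightarrow> \<exists>c. \<forall>x\<in>H. \<bar>p (h \<otimes> x) - p x\<bar> \<le> c"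
  shows "\<exists>\<phi> :: 'a \<Rightarrow> real. (\<forall>h\<in>H. \<forall>h'\<in>H. \<phi> (h \<otimes> h') = \<phi> h + \<phi> h') \<and>
           (\<forall>h\<in>H. \<forall>k. (\<forall>x\<in>H. p (h \<otimes> x) = p x + k) \<longrightarrow> \<phi> h = of_int k)"
proof -
  interpret H: subgroup H G by fact
  \<comment> \<open>The chosen representative depends only on the coset, so left multiplication by
    \<open>H\<close> does not change it. The factor \<open>g \<otimes> inv (t g)\<close> is the
    coordinate of \<open>g\<close> in \<open>H\<close>, and \<open>p'\<close> reads off
    \<open>p\<close> there.\<close>
  define t where "t g = (SOME x. x \<in> H #> g)" for g
  define p' where "p' g = p (g \<otimes> inv (t g))" for g
  have tr: "g \<otimes> inv (t g) \<in> H" "t g \<in> carrier G" if g: "g \<in> carrier G" for g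
  proof -
    have "t g \<in> H #> g"
      unfolding t_def by (rule someI[of _ g]) (rule rcos_self[OF g H])
    then obtain h where "h \<in> H" "t g = h \<otimes> g" by (auto simp: r_coset_def)
    moreover have "g \<otimes> inv (h \<otimes> g) = inv h" if "h \<in> H" for h
      using that g by (simp add: inv_mult_group m_assoc[symmetric])
    ultimately show "g \<otimes> inv (t g) \<in> H" "t g \<in> carrier G" using g by auto
  qed
  have t_mult: "t (h \<otimes> g) = t g" if "h \<in> H" "g \<in> carrier G" for h g
  proof -
    have "H #> (h \<otimes> g) = H #> g"
      using coset_mult_assoc[OF H.subset, of h g] coset_join2[OF _ H, of h] that by simp
    then show ?thesis by (simp add: t_def)
  qed
  have p'_mult: "p' (h \<otimes> g) = p (h \<otimes> (g \<otimes> inv (t g)))" if "h \<in> H" "g \<in> carrier G" for h g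
    using that tr(2)[OF that(2)] by (simp add: p'_def t_mult m_assoc)
  \<comment> \<open>\<open>d\<close> is a cocycle: \<open>d (h h') g = d h (h' g) + d h' g\<close>.
    Each \<open>d h\<close> is bounded and hence has finite range, and invariance of the average
    under \<open>h'\<close> turns the cocycle identity into additivity.\<close>
  define d where "d h g = p' (h \<otimes> g) - p' g" for h g
  have fin: "finite (d h ` carrier G)" if h: "h \<in> H" for h
  proof -
    obtain c where "\<And>x. x \<in> H \<Longrightarrow> \<bar>p (h \<otimes> x) - p x\<bar> \<le> c" using bounded[OF h] by blast
    then have "\<bar>d h g\<bar> \<le> c" if "g \<in> carrier G" for g
      using tr(1)[OF that] p'_mult[OF h that] by (simp add: d_def p'_def)
    then have "d h ` carrier G \<subseteq> {-c..c}"
      by (intro image_subsetI) (simp add: abs_le_iff minus_le_iff)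
    then show ?thesis by (rule finite_subset) simp
  qed
  show ?thesis
  proof (intro exI[of _ "\<lambda>h. average (d h)"] conjI ballI allI impI)
    fix h h' assume h: "h \<in> H" "h' \<in> H"
    have "average (d (h \<otimes> h')) = average (\<lambda>g. d h (h' \<otimes> g) + d h' g)"
    proof (rule average_cong)
      fix g assume "g \<in> carrier G"
      then have "h \<otimes> h' \<otimes> g = h \<otimes> (h' \<otimes> g)" using h by (simp add: m_assoc)
      then show "d (h \<otimes> h') g = d h (h' \<otimes> g) + d h' g" by (simp add: d_def)
    qed
    also have "\<dots> = average (\<lambda>g. d h (h' \<otimes> g)) + average (d h')"
    proof (rule average_add)
      have "(\<lambda>g. d h (h' \<otimes> g)) ` carrier G \<subseteq> d h ` carrier G"
        using h by (intro image_subsetI imageI) simp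
      then show "finite ((\<lambda>g. d h (h' \<otimes> g)) ` carrier G)" using fin[OF h(1)] by (rule finite_subset)
    qed (rule fin[OF h(2)])
    also have "average (\<lambda>g. d h (h' \<otimes> g)) = average (d h)"
      by (rule average_translate) (use h in simp)
    finally show "average (d (h \<otimes> h')) = average (d h) + average (d h')" .
  next
    fix h k assume h: "h \<in> H" and k: "\<forall>x\<in>H. p (h \<otimes> x) = p x + k"
    have "average (d h) = average (\<lambda>g. k)"
    proof (rule average_cong)
      fix g assume g: "g \<in> carrier G"
      then show "d h g = k"
        using k[rule_format, OF tr(1)[OF g]] p'_mult[OF h g] by (simp add: d_def p'_def)
    qed
    then show "average (d h) = of_int k" by simp
  qed
qed

end

lemma amenable_mean:
  fixes G :: "('a, 'b) monoid_scheme"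
  assumes "group G" "amenable G"
  obtains \<mu> where "mean_group G \<mu>"
proof -
  interpret group G by fact
  obtain \<mu> :: "'a set \<Rightarrow> real" where "\<mu> (carrier G) = 1"
    and "\<forall>A. A \<subseteq> carrier G \<longrightarrow> 0 \<le> \<mu> A"
    and "\<forall>A B. A \<subseteq> carrier G \<longrightarrow> B \<subseteq> carrier G \<longrightarrow> A \<inter> B = {} \<longrightarrow> \<mu> (A \<union> B) = \<mu> A + \<mu> B"
    and "\<forall>g\<in>carrier G. \<forall>A. A \<subseteq> carrier G \<longrightarrow> \<mu> (g <#\<^bsub>G\<^esub> A) = \<mu> A"
    using assms(2) unfolding amenable_def by (elim exE conjE)
  then have "mean_group G \<mu>" by unfold_locales simp_all
  then show thesis by (rule that)
qed

section \<open>Locally invariant orders\<close>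

lemma (in group) mult_inv_cancel:
  assumes "x \<in> carrier G" "y \<in> carrier G"
  shows "x \<otimes> (inv x \<otimes> y) = y" "inv x \<otimes> (x \<otimes> y) = y"
  using assms by (simp_all add: m_assoc[symmetric])

locale locally_invariant_ordered = group G for G (structure) +
  fixes less :: "'a \<Rightarrow> 'a \<Rightarrow> bool" (infix \<open>\<prec>\<close> 50)
  assumes less_irrefl: "x \<in> carrier G \<Longrightarrow> \<not> x \<prec> x"
    and less_trans: "\<lbrakk>x \<prec> y; y \<prec> z; x \<in> carrier G; y \<in> carrier G; z \<in> carrier G\<rbrakk> \<Longrightarrow> x \<prec> z"
    and dichotomy: "\<lbrakk>x \<in> carrier G; y \<in> carrier G; y \<noteq> \<one>\<rbrakk> \<Longrightarrow> x \<prec> x \<otimes> y \<or> x \<prec> x \<otimes> inv y"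
begin

lemma less_asym: "\<lbrakk>x \<prec> y; x \<in> carrier G; y \<in> carrier G\<rbrakk> \<Longrightarrow> \<not> y \<prec> x"
  using less_irrefl less_trans by blast

text \<open>One of \<open>x v v\<close> and \<open>x v (inv v) = x\<close> lies above
  \<open>x v\<close>; the second is excluded by \<open>x \<prec> x v\<close>.\<close>

lemma rise:
  assumes "x \<in> carrier G" "v \<in> carrier G" "x \<prec> x \<otimes> v"
  shows "x \<otimes> v \<prec> x \<otimes> v \<otimes> v"
proof -
  have "v \<noteq> \<one>" using assms less_irrefl by force
  moreover have "x \<otimes> v \<otimes> inv v = x" using assms by (simp add: m_assoc)
  moreover have "\<not> x \<otimes> v \<prec> x" using assms by (intro less_asym) simp_all
  ultimately show ?thesis using dichotomy[of "x \<otimes> v" v] assms by simp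
qed

lemma rise_step:
  fixes n :: nat
  assumes "x \<in> carrier G" "v \<in> carrier G" "x \<prec> x \<otimes> v"
  shows "x \<otimes> v [^] n \<prec> x \<otimes> v [^] Suc n"
proof (induction n)
  case (Suc n)
  have step: "x \<otimes> v [^] Suc k = x \<otimes> v [^] k \<otimes> v" for k :: nat
    using assms by (simp add: m_assoc)
  show ?case
    unfolding step[of "Suc n"] using Suc rise[of "x \<otimes> v [^] n" v] assms unfolding step by simp
qed (use assms in simp)

lemma rise_power:
  fixes n :: nat
  assumes "x \<in> carrier G" "v \<in> carrier G" "x \<prec> x \<otimes> v" "0 < n"
  shows "x \<prec> x \<otimes> v [^] n"
  using \<open>0 < n\<close>
proof (induction n)
  case (Suc n)
  show ?case
  proof (cases "n = 0")
    case False
    then have "x \<prec> x \<otimes> v [^] n" using Suc.IH by simp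
    then show ?thesis
      by (rule less_trans[OF _ rise_step[OF assms(1-3)]]) (use assms in simp_all)
  qed (use assms in simp)
qed simp

text \<open>By \<open>rise_step\<close>, a coset \<open>{x \<otimes> v [^] n}\<close> has at most one valley. The three lemmas
  below say that an element \<open>a\<close> at which an undesirable configuration is seen does not see it again
  at \<open>a \<otimes> y [^] n\<close>, so that the set of such \<open>a\<close> is null.\<close>

lemma valley_wandering:
  fixes n :: nat
  assumes a: "a \<in> carrier G" and y: "y \<in> carrier G" and "0 < n"
    and "a \<prec> a \<otimes> y" and "a \<otimes> y [^] n \<prec> a \<otimes> y [^] n \<otimes> inv y"
  shows False
proof -
  obtain m where n: "n = Suc m" using \<open>0 < n\<close> gr0_implies_Suc by blast
  have "a \<otimes> y [^] n \<otimes> inv y = a \<otimes> y [^] m"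
    using a y by (simp add: n m_assoc)
  with assms(5) have "a \<otimes> y [^] Suc m \<prec> a \<otimes> y [^] m" by (simp only: n)
  with rise_step[OF a y assms(4), of m] show False
    using less_asym a y by (meson m_closed nat_pow_closed)
qed

lemma flat_valley_wandering:
  fixes n :: nat
  assumes a: "a \<in> carrier G" and w: "w \<in> carrier G" "w \<noteq> \<one>" and "0 < n"
    and "\<not> a \<otimes> w \<prec> a" and "\<not> a \<otimes> w [^] n \<prec> a \<otimes> w [^] n \<otimes> w"
  shows False
proof -
  obtain m where n: "n = Suc m" using \<open>0 < n\<close> gr0_implies_Suc by blast
  have "a \<otimes> w \<otimes> inv w = a" using a w by (simp add: m_assoc)
  \<comment> \<open>Going back from \<open>a w\<close> to \<open>a\<close> does not rise, so the
    dichotomy forces a rise from \<open>a w\<close> in the direction of \<open>w\<close>. It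
    persists at all later powers, in particular at \<open>a w^n\<close>.\<close>
  then have "a \<otimes> w \<prec> a \<otimes> w \<otimes> w" using dichotomy[of "a \<otimes> w" w] assms(5) a w by simp
  then have "a \<otimes> w \<otimes> w [^] m \<prec> a \<otimes> w \<otimes> w [^] Suc m"
    using a w by (intro rise_step) simp_all
  moreover have "a \<otimes> w \<otimes> w [^] k = a \<otimes> w [^] Suc k" for k
    unfolding nat_pow_Suc2[OF w(1)] using a w by (simp add: m_assoc)
  moreover have "a \<otimes> w [^] Suc n = a \<otimes> w [^] n \<otimes> w"
    using a w by (simp add: m_assoc)
  ultimately show False using assms(6) by (simp only: n)
qed

lemma product_wandering:
  fixes n :: nat
  assumes a: "a \<in> carrier G" and y: "y \<in> carrier G" and z: "z \<in> carrier G" and "0 < n"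
    and "a \<prec> a \<otimes> y" "a \<otimes> y \<otimes> z \<prec> a"
    and "a \<otimes> y [^] n \<prec> a \<otimes> y [^] n \<otimes> z"
    and "a \<otimes> y [^] n \<otimes> y \<otimes> z \<prec> a \<otimes> y [^] n"
  shows False
proof -
  obtain m where n: "n = Suc m" using \<open>0 < n\<close> gr0_implies_Suc by blast
  \<comment> \<open>Write \<open>a' = a y^n\<close>. Right multiplication by the conjugate
    \<open>?v\<close> walks from \<open>?x = a y^(n+1) z\<close> through the points
    \<open>a y^j z\<close> with \<open>j\<close> decreasing. The first step rises, since
    \<open>?x \<prec> a' \<prec> a' z\<close>, so the walk rises all the way to
    \<open>a y z\<close>. Hence \<open>a' z\<close> is at most \<open>a y z\<close>, which lies
    below \<open>a\<close> and thus below \<open>a'\<close>, contrary to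
    \<open>a' \<prec> a' z\<close>.\<close>
  let ?a' = "a \<otimes> y [^] n"
  let ?x = "?a' \<otimes> y \<otimes> z" and ?v = "inv z \<otimes> inv y \<otimes> z"
  have xv: "?x \<otimes> ?v = ?a' \<otimes> z"
    using a y z by (simp add: m_assoc mult_inv_cancel)
  have conj_pow: "?v [^] k = inv z \<otimes> inv (y [^] k) \<otimes> z" for k :: nat
  proof (induction k)
    case (Suc k)
    have "?v [^] Suc k = inv z \<otimes> (inv (y [^] k) \<otimes> (z \<otimes> inv z) \<otimes> inv y) \<otimes> z"
      unfolding nat_pow_Suc Suc using y z by (simp only: m_assoc m_closed inv_closed nat_pow_closed)
    also have "inv (y [^] k) \<otimes> (z \<otimes> inv z) \<otimes> inv y = inv (y [^] Suc k)"
      unfolding nat_pow_Suc2[OF y] using y z by (simp add: inv_mult_group)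
    finally show ?case .
  qed (use z in simp)
  have end_eq: "?a' \<otimes> z \<otimes> ?v [^] m = a \<otimes> y \<otimes> z"
  proof -
    have "?a' \<otimes> z \<otimes> ?v [^] m = a \<otimes> y \<otimes> (y [^] m \<otimes> (z \<otimes> inv z) \<otimes> inv (y [^] m)) \<otimes> z"
      unfolding conj_pow n nat_pow_Suc2[OF y]
      using a y z by (simp only: m_assoc m_closed inv_closed nat_pow_closed)
    then show ?thesis using a y z by simp
  qed
  have "?x \<prec> ?x \<otimes> ?v"
    unfolding xv by (rule less_trans[OF assms(8,7)]) (use a y z in simp_all)
  then have "?a' \<otimes> z \<prec> ?a' \<otimes> z \<otimes> ?v"
    using rise[of ?x ?v] a y z xv by simp
  then have "?a' \<otimes> z = a \<otimes> y \<otimes> z \<or> ?a' \<otimes> z \<prec> a \<otimes> y \<otimes> z"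
    using rise_power[of "?a' \<otimes> z" ?v m] a y z end_eq by (cases "m = 0") simp_all
  moreover have "a \<prec> ?a'" using a y assms(4,5) by (intro rise_power)
  ultimately have "?a' \<otimes> z \<prec> ?a'"
    using assms(6) less_trans[of "?a' \<otimes> z" "a \<otimes> y \<otimes> z" ?a']
      less_trans[of "a \<otimes> y \<otimes> z" a ?a'] a y z by auto
  then show False using less_asym[OF assms(7)] a y z by simp
qed

end

section \<open>Left orders from positive cones\<close>

lemma left_orderable_of_positive_cone:
  fixes G :: "('a, 'b) monoid_scheme" (structure)
  assumes "group G"
    and irrefl: "\<not> pos \<one>"
    and mult: "\<And>x y. \<lbrakk>x \<in> carrier G; y \<in> carrier G; pos x; pos y\<rbrakk> \<Longrightarrow> pos (x \<otimes> y)"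
    and total: "\<And>x. \<lbrakk>x \<in> carrier G; x \<noteq> \<one>\<rbrakk> \<Longrightarrow> pos x \<or> pos (inv x)"
  shows "left_orderable G"
proof -
  interpret group G by fact
  let ?r = "\<lambda>x y. pos (inv x \<otimes> y)"
  have "transp_on (carrier G) ?r"
  proof (rule transp_onI)
    fix x y z assume "x \<in> carrier G" "y \<in> carrier G" "z \<in> carrier G" "?r x y" "?r y z"
    then have "pos ((inv x \<otimes> y) \<otimes> (inv y \<otimes> z))"
      using mult[of "inv x \<otimes> y" "inv y \<otimes> z"] by simp
    moreover have "inv x \<otimes> y \<otimes> (inv y \<otimes> z) = inv x \<otimes> z"
      using \<open>x \<in> carrier G\<close> \<open>y \<in> carrier G\<close> \<open>z \<in> carrier G\<close> by (simp add: m_assoc mult_inv_cancel)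
    ultimately show "?r x z" by simp
  qed
  moreover have "irreflp_on (carrier G) ?r"
    using irrefl by (intro irreflp_onI) simp
  moreover have "totalp_on (carrier G) ?r"
  proof (rule totalp_onI)
    fix x y assume xy: "x \<in> carrier G" "y \<in> carrier G" "x \<noteq> y"
    then have "inv x \<otimes> y \<noteq> \<one>" by (metis inv_equality inv_inv inv_closed)
    with total[of "inv x \<otimes> y"] xy show "?r x y \<or> ?r y x"
      by (simp add: inv_mult_group)
  qed
  moreover have "left_invariant G ?r"
    unfolding left_invariant_def
  proof (intro ballI impI)
    fix x y g assume c: "x \<in> carrier G" "y \<in> carrier G" "g \<in> carrier G" "?r x y"
    then have "inv (g \<otimes> x) \<otimes> (g \<otimes> y) = inv x \<otimes> (inv g \<otimes> g) \<otimes> y"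
      by (simp only: inv_mult_group m_assoc m_closed inv_closed)
    then show "?r (g \<otimes> x) (g \<otimes> y)" using c by simp
  qed
  ultimately show ?thesis
    unfolding left_orderable_def total_order_of_def partial_order_of_def by blast
qed

lemma left_orderable_of_locally_invariant:
  fixes G :: "('a, 'b) monoid_scheme" (structure)
  assumes "mean_group G \<mu>" "locally_invariant_order G r"
  shows "left_orderable G"
proof -
  interpret mean_group G \<mu> by fact
  interpret locally_invariant_ordered G r
    using assms(2) unfolding locally_invariant_order_def partial_order_of_def
    by unfold_locales (meson transp_onD irreflp_onD)+
  show ?thesis
  proof (rule wandering_ultrafilter_right)
    fix U
    assume "U \<noteq> bot" and ultra: "\<And>P. eventually P U \<or> eventually (\<lambda>x. \<not> P x) U"
      and carr: "eventually (\<lambda>a. a \<in> carrier G) U"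
      and wandering: "\<And>P g. \<lbrakk>g \<in> carrier G; \<And>a n. \<lbrakk>a \<in> carrier G; (0::nat) < n; P a; P (a \<otimes> g [^] n)\<rbrakk> \<Longrightarrow> False\<rbrakk>
          \<Longrightarrow> eventually (\<lambda>a. \<not> P a) U"
    \<comment> \<open>The elements above the identity in the limit along \<open>U\<close> of the
      translated orders, in which \<open>x\<close> lies below \<open>y\<close> when
      \<open>a x \<prec> a y\<close>.\<close>
    define pos where "pos y \<longleftrightarrow> eventually (\<lambda>a. r a (a \<otimes> y)) U" for y
    have not_both: "\<not> (pos y \<and> pos (inv y))" if y: "y \<in> carrier G" for y
    proof
      assume "pos y \<and> pos (inv y)"
      then have "eventually (\<lambda>a. r a (a \<otimes> y)) U" "eventually (\<lambda>a. r a (a \<otimes> inv y)) U"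
        unfolding pos_def by simp_all
      moreover have "eventually (\<lambda>a. \<not> (r a (a \<otimes> y) \<and> r a (a \<otimes> inv y))) U"
      proof (rule wandering[OF y])
        fix a and n :: nat
        assume "a \<in> carrier G" "0 < n"
          and "r a (a \<otimes> y) \<and> r a (a \<otimes> inv y)"
          and "r (a \<otimes> y [^] n) (a \<otimes> y [^] n \<otimes> y) \<and> r (a \<otimes> y [^] n) (a \<otimes> y [^] n \<otimes> inv y)"
        then show False using valley_wandering[of a y n] y by simp
      qed
      ultimately have "eventually (\<lambda>a. False) U"
        by eventually_elim blast
      with \<open>U \<noteq> bot\<close> show False by (simp add: trivial_limit_def)
    qed
    show ?thesis
    proof (rule left_orderable_of_positive_cone[of G pos])
      show "group G" by (rule is_group)
      show "\<not> pos \<one>" using not_both[OF one_closed] by simp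
    next
      fix x assume x: "x \<in> carrier G" "x \<noteq> \<one>"
      from ultra[of "\<lambda>a. r a (a \<otimes> x)"] show "pos x \<or> pos (inv x)"
      proof
        assume falls: "eventually (\<lambda>a. \<not> r a (a \<otimes> x)) U"
        have step: "r a (a \<otimes> inv x)" if "a \<in> carrier G" "\<not> r a (a \<otimes> x)" for a
          using dichotomy[OF that(1) x] that(2) by simp
        from carr falls have "pos (inv x)"
          unfolding pos_def by eventually_elim (rule step)
        then show ?thesis ..
      qed (simp add: pos_def)
    next
      fix y z assume y: "y \<in> carrier G" and z: "z \<in> carrier G" and pos: "pos y" "pos z"
      let ?w = "y \<otimes> z"
      have w: "?w \<in> carrier G" using y z by simp
      have w1: "?w \<noteq> \<one>"
      proof
        assume "?w = \<one>"
        then have "inv z = y" using z y by (rule inv_equality)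
        then show False using not_both[OF z] pos by simp
      qed
      show "pos ?w"
      proof (rule ccontr)
        assume "\<not> pos ?w"
        then have *: "eventually (\<lambda>a. \<not> r a (a \<otimes> ?w)) U" using ultra unfolding pos_def by blast
        \<comment> \<open>The given order is only partial, so the failure of
          \<open>a \<prec> a w\<close> could mean incomparability. As this cannot recur along the
          powers of \<open>w\<close>, it follows that \<open>a w \<prec> a\<close> for
          \<open>U\<close>-almost every \<open>a\<close>, the situation excluded by
          \<open>product_wandering\<close>.\<close>
        have flat: "eventually (\<lambda>a. \<not> (\<not> r a (a \<otimes> ?w) \<and> \<not> r (a \<otimes> ?w) a)) U"
        proof (rule wandering[OF w])
          fix a and n :: nat
          assume "a \<in> carrier G" "0 < n"
            and "\<not> r a (a \<otimes> ?w) \<and> \<not> r (a \<otimes> ?w) a"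
            and "\<not> r (a \<otimes> ?w [^] n) (a \<otimes> ?w [^] n \<otimes> ?w) \<and> \<not> r (a \<otimes> ?w [^] n \<otimes> ?w) (a \<otimes> ?w [^] n)"
          then show False by (elim conjE) (rule flat_valley_wandering[OF _ w w1])
        qed
        have "eventually (\<lambda>a. \<not> (r a (a \<otimes> y) \<and> r a (a \<otimes> z) \<and> r (a \<otimes> y \<otimes> z) a)) U"
        proof (rule wandering[OF y])
          fix a and n :: nat
          assume "a \<in> carrier G" "0 < n"
            and "r a (a \<otimes> y) \<and> r a (a \<otimes> z) \<and> r (a \<otimes> y \<otimes> z) a"
            and "r (a \<otimes> y [^] n) (a \<otimes> y [^] n \<otimes> y) \<and> r (a \<otimes> y [^] n) (a \<otimes> y [^] n \<otimes> z) \<and>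
              r (a \<otimes> y [^] n \<otimes> y \<otimes> z) (a \<otimes> y [^] n)"
          then show False by (elim conjE) (rule product_wandering[OF _ y z])
        qed
        with carr flat * pos[unfolded pos_def] have "eventually (\<lambda>a. False) U"
          by eventually_elim (use y z in \<open>simp add: m_assoc\<close>)
        with \<open>U \<noteq> bot\<close> show False by (simp add: trivial_limit_def)
      qed
    qed
  qed
qed

section \<open>Conradian orders\<close>

locale left_ordered = group G for G (structure) +
  fixes less :: "'a \<Rightarrow> 'a \<Rightarrow> bool" (infix \<open>\<prec>\<close> 50)
  assumes less_irrefl: "x \<in> carrier G \<Longrightarrow> \<not> x \<prec> x"
    and less_trans: "\<lbrakk>x \<prec> y; y \<prec> z; x \<in> carrier G; y \<in> carrier G; z \<in> carrier G\<rbrakk> \<Longrightarrow> x \<prec> z"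
    and less_total: "\<lbrakk>x \<in> carrier G; y \<in> carrier G; x \<noteq> y\<rbrakk> \<Longrightarrow> x \<prec> y \<or> y \<prec> x"
    and mult_less: "\<lbrakk>x \<prec> y; x \<in> carrier G; y \<in> carrier G; g \<in> carrier G\<rbrakk> \<Longrightarrow> g \<otimes> x \<prec> g \<otimes> y"
begin

definition le :: "'a \<Rightarrow> 'a \<Rightarrow> bool" (infix \<open>\<preceq>\<close> 50)
  where "x \<preceq> y \<longleftrightarrow> x = y \<or> x \<prec> y"

lemma le_refl [simp]: "x \<preceq> x"
  by (simp add: le_def)

lemma less_imp_le: "x \<prec> y \<Longrightarrow> x \<preceq> y"
  by (simp add: le_def)

lemma not_less_iff: "\<lbrakk>x \<in> carrier G; y \<in> carrier G\<rbrakk> \<Longrightarrow> \<not> x \<prec> y \<longleftrightarrow> y \<preceq> x"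
  unfolding le_def using less_irrefl less_total less_trans by blast

lemma le_less_trans: "\<lbrakk>x \<preceq> y; y \<prec> z; x \<in> carrier G; y \<in> carrier G; z \<in> carrier G\<rbrakk> \<Longrightarrow> x \<prec> z"
  unfolding le_def using less_trans by blast

lemma less_le_trans: "\<lbrakk>x \<prec> y; y \<preceq> z; x \<in> carrier G; y \<in> carrier G; z \<in> carrier G\<rbrakk> \<Longrightarrow> x \<prec> z"
  unfolding le_def using less_trans by blast

lemma le_trans: "\<lbrakk>x \<preceq> y; y \<preceq> z; x \<in> carrier G; y \<in> carrier G; z \<in> carrier G\<rbrakk> \<Longrightarrow> x \<preceq> z"
  unfolding le_def using less_trans by blast

lemma mult_le: "\<lbrakk>x \<preceq> y; x \<in> carrier G; y \<in> carrier G; g \<in> carrier G\<rbrakk> \<Longrightarrow> g \<otimes> x \<preceq> g \<otimes> y"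
  unfolding le_def using mult_less by blast

lemma mult_less_iff:
  assumes "x \<in> carrier G" "y \<in> carrier G" "g \<in> carrier G"
  shows "g \<otimes> x \<prec> g \<otimes> y \<longleftrightarrow> x \<prec> y"
proof
  assume "g \<otimes> x \<prec> g \<otimes> y"
  then have "inv g \<otimes> (g \<otimes> x) \<prec> inv g \<otimes> (g \<otimes> y)"
    by (rule mult_less) (use assms in simp_all)
  then show "x \<prec> y" using assms by (simp add: mult_inv_cancel)
qed (rule mult_less[OF _ assms])

lemma power_mult_le:
  fixes n :: nat
  assumes x: "x \<in> carrier G" and y: "y \<in> carrier G" and "x \<otimes> y \<preceq> y"
  shows "x [^] n \<otimes> y \<preceq> y"
proof (induction n)
  case (Suc n)
  have "x \<otimes> (x [^] n \<otimes> y) \<preceq> x \<otimes> y" using Suc x y by (intro mult_le) simp_all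
  then have "x \<otimes> (x [^] n \<otimes> y) \<preceq> y" by (rule le_trans) (use assms in simp_all)
  moreover have "x [^] Suc n \<otimes> y = x \<otimes> (x [^] n \<otimes> y)"
    unfolding nat_pow_Suc2[OF x] using x y by (simp add: m_assoc)
  ultimately show ?case by (simp only:)
qed (use y in simp)

lemma le_power_mult:
  fixes n :: nat
  assumes x: "x \<in> carrier G" and y: "y \<in> carrier G" and "y \<preceq> x \<otimes> y"
  shows "y \<preceq> x [^] n \<otimes> y"
proof (induction n)
  case (Suc n)
  have "x \<otimes> y \<preceq> x \<otimes> (x [^] n \<otimes> y)" using Suc x y by (intro mult_le) simp_all
  then have "y \<preceq> x \<otimes> (x [^] n \<otimes> y)" by (rule le_trans[OF assms(3)]) (use assms in simp_all)
  moreover have "x [^] Suc n \<otimes> y = x \<otimes> (x [^] n \<otimes> y)"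
    unfolding nat_pow_Suc2[OF x] using x y by (simp add: m_assoc)
  ultimately show ?case by (simp only:)
qed (use y in simp)

text \<open>The relation \<open>\<lambda>x y. x \<otimes> a \<prec> y \<otimes> a\<close> is again a left order, and for it \<open>f\<close> and \<open>g\<close> violate the
  Conrad inequality; this cannot recur along the powers of \<open>f \<otimes> g\<close>.\<close>

lemma conrad_failure_wandering:
  fixes n :: nat
  assumes f: "f \<in> carrier G" and g: "g \<in> carrier G" and a: "a \<in> carrier G" and "0 < n"
    and h: "h = f \<otimes> g"
    and "a \<prec> f \<otimes> a" "a \<prec> g \<otimes> a" "\<not> g \<otimes> a \<prec> f \<otimes> (g \<otimes> g) \<otimes> a"
    and "h [^] n \<otimes> a \<prec> f \<otimes> (h [^] n \<otimes> a)"
  shows False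
proof -
  obtain m where n: "n = Suc m" using \<open>0 < n\<close> gr0_implies_Suc by blast
  have hc: "h \<in> carrier G" using f g h by simp
  \<comment> \<open>The failure of the Conrad inequality at \<open>a\<close> says that
    \<open>h\<close> moves \<open>g a\<close> weakly down. The same then holds for the powers of
    \<open>h\<close>, which confines every \<open>h^n a\<close> below \<open>g a\<close>.\<close>
  have "h \<otimes> (g \<otimes> a) = f \<otimes> (g \<otimes> g) \<otimes> a" using f g a by (simp add: h m_assoc)
  then have "h \<otimes> (g \<otimes> a) \<preceq> g \<otimes> a" using assms(8) f g a not_less_iff by simp
  then have upper: "h [^] n \<otimes> (g \<otimes> a) \<preceq> g \<otimes> a"
    using hc g a by (intro power_mult_le) simp_all
  have "h [^] n \<otimes> a \<prec> h [^] n \<otimes> (g \<otimes> a)" using assms(7) hc g a by (intro mult_less) simp_all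
  then have "h [^] n \<otimes> a \<prec> g \<otimes> a" by (rule less_le_trans[OF _ upper]) (use hc g a in simp_all)
  then have "f \<otimes> (h [^] n \<otimes> a) \<prec> f \<otimes> (g \<otimes> a)" using hc f g a by (intro mult_less) simp_all
  moreover have "f \<otimes> (g \<otimes> a) = h \<otimes> a" using f g a by (simp add: h m_assoc)
  ultimately have below: "h [^] n \<otimes> a \<prec> h \<otimes> a"
    using less_trans[OF assms(9)] hc f a by simp
  \<comment> \<open>In the other direction \<open>h\<close> moves \<open>a\<close> up, so
    \<open>h a\<close> is at most \<open>h^n a\<close> for positive \<open>n\<close>, which
    contradicts \<open>below\<close>.\<close>
  have "f \<otimes> a \<prec> f \<otimes> (g \<otimes> a)" using assms(7) f g a by (intro mult_less) simp_all
  then have "a \<prec> h \<otimes> a"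
    unfolding \<open>f \<otimes> (g \<otimes> a) = h \<otimes> a\<close> by (rule less_trans[OF assms(6)]) (use f a hc in simp_all)
  then have "a \<preceq> h [^] m \<otimes> a" using hc a by (intro le_power_mult less_imp_le)
  then have "h \<otimes> a \<preceq> h \<otimes> (h [^] m \<otimes> a)" using hc a by (intro mult_le) simp_all
  moreover have "h [^] n \<otimes> a = h \<otimes> (h [^] m \<otimes> a)"
    unfolding n nat_pow_Suc2[OF hc] using hc a by (simp add: m_assoc)
  ultimately have "h \<otimes> a \<preceq> h [^] n \<otimes> a" by simp
  with below have "h [^] n \<otimes> a \<prec> h [^] n \<otimes> a" by (rule less_le_trans) (use hc a in simp_all)
  then show False using less_irrefl hc a by simp
qed

lemma finite_has_greatest:
  assumes "finite A" "A \<noteq> {}" "A \<subseteq> carrier G"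
  shows "\<exists>m\<in>A. \<forall>a\<in>A. a \<preceq> m"
  using assms
proof (induction rule: finite_ne_induct)
  case (insert x A)
  then obtain m where m: "m \<in> A" "\<And>a. a \<in> A \<Longrightarrow> a \<preceq> m" by auto
  have c: "x \<in> carrier G" "m \<in> carrier G" "\<And>a. a \<in> A \<Longrightarrow> a \<in> carrier G" using insert.prems m(1) by auto
  show ?case
  proof (cases "x \<preceq> m")
    case False
    then have "m \<preceq> x" using not_less_iff[OF c(1,2)] less_imp_le by blast
    then have "a \<preceq> x" if "a \<in> A" for a by (rule le_trans[OF m(2)[OF that]]) (use c that in simp_all)
    then show ?thesis by simp
  qed (use m in auto)
qed simp

end

text \<open>The Conrad property is often stated as the existence of some \<open>n\<close> with
  \<open>g \<prec> f g^n\<close>. The form with exponent 2 is the one that recurrence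
  delivers.\<close>

locale conradian = left_ordered +
  assumes conrad: "\<lbrakk>f \<in> carrier G; g \<in> carrier G; \<one> \<prec> f; \<one> \<prec> g\<rbrakk> \<Longrightarrow> g \<prec> f \<otimes> (g \<otimes> g)"

text \<open>Right multiplication by \<open>a\<close> commutes with left multiplication, so each
  relation \<open>r (x a) (y a)\<close> is again a left-invariant total order. These properties pass
  to the limit \<open>s\<close> along the ultrafilter, and failures of the Conrad inequality
  disappear in it because they cannot recur.\<close>

lemma conradian_order_exists:
  fixes G :: "('a, 'b) monoid_scheme" (structure)
  assumes "mean_group G \<mu>" "total_order_of G r" "left_invariant G r"
  shows "\<exists>r'. conradian G r'"
proof -
  interpret mean_group G \<mu> by fact
  interpret left_ordered G r
  proof
    show "\<not> r x x" if "x \<in> carrier G" for x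
      using assms(2) that unfolding total_order_of_def partial_order_of_def by (meson irreflp_onD)
    show "r x z" if "r x y" "r y z" "x \<in> carrier G" "y \<in> carrier G" "z \<in> carrier G" for x y z
      using assms(2) that unfolding total_order_of_def partial_order_of_def by (meson transp_onD)
    show "r x y \<or> r y x" if "x \<in> carrier G" "y \<in> carrier G" "x \<noteq> y" for x y
      using assms(2) that totalp_onD[of "carrier G" r x y] unfolding total_order_of_def by blast
    show "r (g \<otimes> x) (g \<otimes> y)" if "r x y" "x \<in> carrier G" "y \<in> carrier G" "g \<in> carrier G" for x y g
      using assms(3) that unfolding left_invariant_def by simp
  qed
  show ?thesis
  proof (rule wandering_ultrafilter_left)
    fix U
    assume "U \<noteq> bot" and ultra: "\<And>P. eventually P U \<or> eventually (\<lambda>x. \<not> P x) U"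
      and carr: "eventually (\<lambda>a. a \<in> carrier G) U"
      and wandering: "\<And>P g. \<lbrakk>g \<in> carrier G; \<And>a n. \<lbrakk>a \<in> carrier G; (0::nat) < n; P a; P (g [^] n \<otimes> a)\<rbrakk> \<Longrightarrow> False\<rbrakk>
        \<Longrightarrow> eventually (\<lambda>a. \<not> P a) U"
    define s where "s x y \<longleftrightarrow> eventually (\<lambda>a. r (x \<otimes> a) (y \<otimes> a)) U" for x y
    have total: "s x y \<or> s y x" if xy: "x \<in> carrier G" "y \<in> carrier G" "x \<noteq> y" for x y
      using ultra[of "\<lambda>a. r (x \<otimes> a) (y \<otimes> a)"]
    proof
      assume not_less: "eventually (\<lambda>a. \<not> r (x \<otimes> a) (y \<otimes> a)) U"
      have step: "r (y \<otimes> a) (x \<otimes> a)" if "a \<in> carrier G" "\<not> r (x \<otimes> a) (y \<otimes> a)" for a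
        using less_total[of "x \<otimes> a" "y \<otimes> a"] that xy by simp
      from carr not_less have "s y x" unfolding s_def by eventually_elim (rule step)
      then show ?thesis ..
    qed (simp add: s_def)
    have "conradian G s"
    proof (unfold_locales, goal_cases)
      case (1 x)
      have "\<not> eventually (\<lambda>a. r (x \<otimes> a) (x \<otimes> a)) U"
      proof
        assume "eventually (\<lambda>a. r (x \<otimes> a) (x \<otimes> a)) U"
        with carr have "eventually (\<lambda>a. False) U"
          by eventually_elim (use 1 less_irrefl in simp)
        with \<open>U \<noteq> bot\<close> show False by (simp add: trivial_limit_def)
      qed
      then show ?case by (simp add: s_def)
    next
      case (2 x y z)
      have step: "r (x \<otimes> a) (z \<otimes> a)" if "a \<in> carrier G" "r (x \<otimes> a) (y \<otimes> a)" "r (y \<otimes> a) (z \<otimes> a)" for a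
        using less_trans[OF that(2,3)] that(1) 2 by simp
      from carr 2(1,2)[unfolded s_def] show ?case unfolding s_def by eventually_elim (rule step)
    next
      case (3 x y)
      then show ?case by (rule total)
    next
      case (4 x y g)
      have step: "r (g \<otimes> x \<otimes> a) (g \<otimes> y \<otimes> a)" if "a \<in> carrier G" "r (x \<otimes> a) (y \<otimes> a)" for a
        using mult_less[OF that(2), of g] that(1) 4 by (simp add: m_assoc)
      from carr 4(1)[unfolded s_def] show ?case unfolding s_def by eventually_elim (rule step)
    next
      case (5 f g)
      let ?P = "\<lambda>a. r a (f \<otimes> a) \<and> r a (g \<otimes> a) \<and> \<not> r (g \<otimes> a) (f \<otimes> (g \<otimes> g) \<otimes> a)"
      have "f \<otimes> g \<in> carrier G" using 5 by simp
      then have never: "eventually (\<lambda>a. \<not> ?P a) U"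
      proof (rule wandering)
        fix a and n :: nat assume "a \<in> carrier G" "0 < n" "?P a" "?P ((f \<otimes> g) [^] n \<otimes> a)"
        then show False by (elim conjE) (rule conrad_failure_wandering[OF 5(1,2) _ _ refl])
      qed
      have step: "r (g \<otimes> a) (f \<otimes> (g \<otimes> g) \<otimes> a)"
        if "a \<in> carrier G" "\<not> ?P a" "r (\<one> \<otimes> a) (f \<otimes> a)" "r (\<one> \<otimes> a) (g \<otimes> a)" for a
        using that by simp
      from carr never 5(3,4)[unfolded s_def] show ?case
        unfolding s_def by eventually_elim (rule step)
    qed
    then show ?thesis by (rule exI[of _ s])
  qed
qed

section \<open>Powers in a Conradian order\<close>

context conradian
begin

lemma one_less_power:
  fixes n :: nat
  assumes "g \<in> carrier G" "\<one> \<prec> g" "0 < n"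
  shows "\<one> \<prec> g [^] n"
  using assms(3)
proof (induction n)
  case (Suc n)
  have "\<one> \<preceq> g [^] n" using Suc.IH by (cases "n = 0") (simp_all add: less_imp_le)
  moreover have "g [^] n \<prec> g [^] n \<otimes> g"
    using mult_less[OF assms(2), of "g [^] n"] assms(1) by simp
  ultimately have "\<one> \<prec> g [^] n \<otimes> g" by (rule le_less_trans) (use assms(1) in simp_all)
  then show ?case by simp
qed simp

text \<open>Left invariance alone does not allow multiplying \<open>a \<prec> b\<close> by itself.
  The Conrad inequality for \<open>inv a b\<close> and \<open>c = b^k\<close> gives
  \<open>a c \<prec> b c c\<close>, so a bound \<open>a^n \<prec> b^k\<close> yields
  \<open>a^(n+1) \<prec> b^(2k+1)\<close>.\<close>

lemma power_dominated:
  fixes n :: nat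
  assumes a: "a \<in> carrier G" "\<one> \<prec> a" and b: "b \<in> carrier G" "a \<prec> b"
  shows "\<exists>k::nat. a [^] n \<prec> b [^] k"
proof (induction n)
  case 0
  have "\<one> \<prec> b" using less_trans[OF a(2) b(2)] a(1) b(1) by simp
  then show ?case using b(1) by (intro exI[of _ 1]) simp
next
  case (Suc n)
  then obtain k :: nat where k: "a [^] n \<prec> b [^] k" by blast
  let ?w = "inv a \<otimes> b" and ?c = "b [^] k"
  have "\<one> \<preceq> a [^] n"
    using one_less_power[OF a, of n] by (cases "n = 0") (simp_all add: less_imp_le)
  then have c: "\<one> \<prec> ?c" by (rule le_less_trans[OF _ k]) (use a b in simp_all)
  have "\<one> \<prec> ?w"
    using mult_less[OF b(2), of "inv a"] a b by simp
  then have "?c \<prec> ?w \<otimes> (?c \<otimes> ?c)" using c a b by (intro conrad) simp_all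
  then have "a \<otimes> ?c \<prec> a \<otimes> (?w \<otimes> (?c \<otimes> ?c))" using a b by (intro mult_less) simp_all
  moreover have "a \<otimes> (?w \<otimes> (?c \<otimes> ?c)) = b [^] (Suc (k + k))"
    unfolding nat_pow_Suc2[OF b(1)] using a b by (simp add: m_assoc mult_inv_cancel nat_pow_mult[symmetric])
  ultimately have "a \<otimes> ?c \<prec> b [^] (Suc (k + k))" by (simp only:)
  moreover have "a \<otimes> a [^] n \<prec> a \<otimes> ?c" using k a b by (intro mult_less) simp_all
  ultimately have "a \<otimes> a [^] n \<prec> b [^] (Suc (k + k))"
    using less_trans[of "a \<otimes> a [^] n" "a \<otimes> ?c"] a b by simp
  then show ?case unfolding nat_pow_Suc2[OF a(1)] by blast
qed

text \<open>If the inequality fails, then \<open>h = f g\<close> moves \<open>g^p\<close> weakly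
  down, so all powers of \<open>h\<close> are bounded by \<open>g^p\<close>. But the Conrad
  inequality for \<open>f\<close> and \<open>h\<close> reads \<open>f g \<prec> f h h\<close>, so
  \<open>g \<prec> h^2\<close>, and by \<open>power_dominated\<close> some power of
  \<open>h^2\<close> exceeds \<open>g^p\<close>.\<close>

lemma conrad_nat_power:
  fixes p :: nat
  assumes f: "f \<in> carrier G" "\<one> \<prec> f" and g: "g \<in> carrier G" "\<one> \<prec> g"
  shows "g [^] p \<prec> f \<otimes> g [^] Suc p"
proof (rule ccontr)
  assume "\<not> g [^] p \<prec> f \<otimes> g [^] Suc p"
  then have le: "f \<otimes> g [^] Suc p \<preceq> g [^] p" using f g not_less_iff by simp
  define h where "h = f \<otimes> g"
  have hc: "h \<in> carrier G" using f g by (simp add: h_def)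
  have "f \<prec> h" using mult_less[OF g(2), of f] f g by (simp add: h_def)
  then have h1: "\<one> \<prec> h" using less_trans[OF f(2)] f hc by simp
  have "h \<otimes> g [^] p = f \<otimes> g [^] Suc p"
    unfolding nat_pow_Suc2[OF g(1)] using f g by (simp add: h_def m_assoc)
  then have "h [^] n \<otimes> g [^] p \<preceq> g [^] p" for n :: nat
    using le hc g by (intro power_mult_le) simp_all
  moreover have "h [^] n \<preceq> h [^] n \<otimes> g [^] p" for n :: nat
  proof -
    have "\<one> \<preceq> g [^] p"
      using one_less_power[OF g, of p] by (cases "p = 0") (simp_all add: less_imp_le)
    then show ?thesis using mult_le[of \<one> "g [^] p" "h [^] n"] hc g by simp
  qed
  ultimately have bound: "h [^] n \<preceq> g [^] p" for n :: nat
    using le_trans[of "h [^] n" "h [^] n \<otimes> g [^] p" "g [^] p"] hc g by simp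
  have "f \<otimes> g \<prec> f \<otimes> (h \<otimes> h)" using conrad[OF f(1) hc f(2) h1] by (simp add: h_def)
  then have "g \<prec> h [^] (2::nat)"
    using mult_less_iff[of g "h \<otimes> h" f] f g hc by (simp add: numeral_2_eq_2)
  then obtain k :: nat where "g [^] p \<prec> (h [^] (2::nat)) [^] k"
    using power_dominated[OF g, of "h [^] (2::nat)" p] hc by auto
  then have "g [^] p \<prec> h [^] (2 * k)" using hc by (simp add: nat_pow_pow)
  then have "g [^] p \<prec> g [^] p" by (rule less_le_trans[OF _ bound]) (use hc g in simp_all)
  then show False using less_irrefl g by simp
qed

text \<open>For negative \<open>p = -(q+1)\<close> a failure makes
  \<open>w = g^q (inv f) g^p\<close> at least the identity. The case of natural exponents, applied
  to \<open>w\<close> unless it is trivial, gives \<open>g^q \<prec> w g^(q+1)\<close>. Since the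
  right side equals \<open>g^q (inv f)\<close>, which lies below \<open>g^q\<close>, this is
  impossible.\<close>

lemma conrad_int_power:
  fixes p :: int
  assumes f: "f \<in> carrier G" "\<one> \<prec> f" and g: "g \<in> carrier G" "\<one> \<prec> g"
  shows "g [^] p \<prec> f \<otimes> g [^] (p + 1)"
proof (cases "0 \<le> p")
  case True
  then obtain n where n: "p = int n" using zero_le_imp_eq_int by blast
  have "p + 1 = int (Suc n)" by (simp add: n)
  then show ?thesis using conrad_nat_power[OF f g, of n] unfolding n by (simp only: int_pow_int)
next
  case False
  define q where "q = nat (- (p + 1))"
  have q: "p + 1 = - int q" using False by (simp add: q_def)
  show ?thesis
  proof (rule ccontr)
    assume "\<not> g [^] p \<prec> f \<otimes> g [^] (p + 1)"
    then have le: "f \<otimes> g [^] (p + 1) \<preceq> g [^] p" using f g not_less_iff by simp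
    define w where "w = g [^] int q \<otimes> inv f \<otimes> g [^] p"
    have wc: "w \<in> carrier G" using f g by (simp add: w_def)
    have "g [^] int q \<otimes> inv f \<otimes> (f \<otimes> g [^] (p + 1)) \<preceq> w"
      unfolding w_def using le f g by (intro mult_le) simp_all
    moreover have "g [^] int q \<otimes> inv f \<otimes> (f \<otimes> g [^] (p + 1)) = \<one>"
      using f g by (simp add: m_assoc mult_inv_cancel q int_pow_mult[symmetric] del: int_pow_int)
    ultimately have w1: "\<one> \<preceq> w" by simp
    have "p = - int (Suc q)" using q by simp
    then have cancel: "g [^] p \<otimes> g [^] Suc q = \<one>"
      using int_pow_neg_int[OF g(1), of "Suc q"] l_inv[of "g [^] Suc q"] g(1) by (simp only: nat_pow_closed)
    have "w \<otimes> g [^] Suc q = g [^] q \<otimes> inv f \<otimes> (g [^] p \<otimes> g [^] Suc q)"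
      unfolding w_def int_pow_int using f g by (simp only: m_assoc m_closed inv_closed nat_pow_closed int_pow_closed)
    then have w_eq: "w \<otimes> g [^] Suc q = g [^] q \<otimes> inv f"
      unfolding cancel using f g by simp
    have "inv f \<prec> \<one>" using mult_less[OF f(2), of "inv f"] f by simp
    then have upper: "w \<otimes> g [^] Suc q \<prec> g [^] q"
      unfolding w_eq using mult_less[of "inv f" \<one> "g [^] q"] f g by simp
    have "g [^] q \<prec> w \<otimes> g [^] Suc q"
    proof (cases "w = \<one>")
      case True
      then show ?thesis using mult_less[OF g(2), of "g [^] q"] g by simp
    next
      case False
      then show ?thesis using w1 wc g by (intro conrad_nat_power) (simp_all add: le_def)
    qed
    then have "g [^] q \<prec> g [^] q"
      using less_trans[OF _ upper] wc g by simp
    then show False using less_irrefl g by simp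
  qed
qed

section \<open>Integer parts relative to the powers of one element\<close>

lemma int_power_less:
  fixes i j :: int
  assumes g: "g \<in> carrier G" "\<one> \<prec> g" and "i < j"
  shows "g [^] i \<prec> g [^] j"
proof -
  define n where "n = nat (j - i)"
  have n: "j = i + int n" "0 < n" using \<open>i < j\<close> by (simp_all add: n_def)
  have "g [^] i \<otimes> \<one> \<prec> g [^] i \<otimes> g [^] n"
    by (rule mult_less[OF one_less_power[OF g n(2)]]) (use g in simp_all)
  then show ?thesis using g by (simp add: n(1) int_pow_mult int_pow_int)
qed

lemma int_power_le: "\<lbrakk>g \<in> carrier G; \<one> \<prec> g; i \<le> j\<rbrakk> \<Longrightarrow> g [^] (i::int) \<preceq> g [^] j"
  using int_power_less[of g i j] by (cases "i = j") (simp_all add: less_imp_le)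

lemma int_power_less_cancel:
  fixes i j :: int
  assumes g: "g \<in> carrier G" "\<one> \<prec> g" and less: "g [^] i \<prec> g [^] j"
  shows "i < j"
proof (rule ccontr)
  assume "\<not> i < j"
  then have "g [^] j \<preceq> g [^] i" using g by (intro int_power_le) simp_all
  then show False using less g not_less_iff[of "g [^] i" "g [^] j"] by simp
qed

text \<open>One \<open>c\<close> has to serve all \<open>p\<close>: this uniformity is what bounds
  the displacement of integer parts independently of the element displaced.\<close>

definition bounded_drift :: "'a \<Rightarrow> 'a \<Rightarrow> bool"
  where "bounded_drift m h \<longleftrightarrow>
    (\<exists>c::int. \<forall>p::int. m [^] (p - c) \<preceq> h \<otimes> m [^] p \<and> h \<otimes> m [^] p \<preceq> m [^] (p + c))"

text \<open>The lower bound is the Conrad inequality for \<open>s\<close> and \<open>m\<close>, the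
  upper one that for \<open>inv s m\<close> and \<open>m\<close>. The latter loses one power of
  \<open>m\<close> and the factor \<open>m = s (inv s m)\<close> costs another, whence the constant
  2.\<close>

lemma bounded_drift_below:
  assumes m: "m \<in> carrier G" "\<one> \<prec> m" and s: "s \<in> carrier G" "\<one> \<prec> s" "s \<preceq> m"
  shows "bounded_drift m s"
  unfolding bounded_drift_def
proof (intro exI[of _ 2] allI conjI)
  fix p :: int
  have "m [^] (p - 1) \<prec> s \<otimes> m [^] p" using conrad_int_power[OF s(1,2) m, of "p - 1"] by simp
  then show "m [^] (p - 2) \<preceq> s \<otimes> m [^] p"
    using less_trans[OF int_power_less[OF m, of "p - 2" "p - 1"]] m s by (intro less_imp_le) simp
  let ?w = "inv s \<otimes> m"
  have w: "?w \<in> carrier G" using m s by simp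
  have "m [^] p \<preceq> ?w \<otimes> m [^] (p + 1)"
  proof (cases "?w = \<one>")
    case True
    then show ?thesis using int_power_le[OF m, of p "p + 1"] m by simp
  next
    case False
    have "inv s \<otimes> s \<preceq> ?w" by (rule mult_le[OF s(3)]) (use m s in simp_all)
    then have "\<one> \<prec> ?w" using False s by (auto simp: le_def)
    then show ?thesis using conrad_int_power[OF w _ m] by (intro less_imp_le)
  qed
  then have "s \<otimes> m [^] p \<preceq> s \<otimes> (?w \<otimes> m [^] (p + 1))"
    by (rule mult_le) (use m s in simp_all)
  moreover have "s \<otimes> (?w \<otimes> m [^] (p + 1)) = m [^] (1::int) \<otimes> m [^] (p + 1)"
    using m s by (simp add: m_assoc mult_inv_cancel)
  moreover have "m [^] (1::int) \<otimes> m [^] (p + 1) = m [^] (p + 2)"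
    using m by (simp only: int_pow_mult[symmetric]) (simp add: algebra_simps)
  ultimately show "s \<otimes> m [^] p \<preceq> m [^] (p + 2)" by simp
qed

lemma bounded_drift_one: "bounded_drift m \<one>" if "m \<in> carrier G"
  unfolding bounded_drift_def using that by (intro exI[of _ 0]) simp

lemma bounded_drift_mult:
  assumes m: "m \<in> carrier G" "\<one> \<prec> m" and h: "h \<in> carrier G" "h' \<in> carrier G"
    and "bounded_drift m h" "bounded_drift m h'"
  shows "bounded_drift m (h \<otimes> h')"
proof -
  obtain c :: int where c: "\<And>p. m [^] (p - c) \<preceq> h \<otimes> m [^] p" "\<And>p. h \<otimes> m [^] p \<preceq> m [^] (p + c)"
    using assms(5) unfolding bounded_drift_def by blast
  obtain c' :: int where c': "\<And>p. m [^] (p - c') \<preceq> h' \<otimes> m [^] p" "\<And>p. h' \<otimes> m [^] p \<preceq> m [^] (p + c')"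
    using assms(6) unfolding bounded_drift_def by blast
  show ?thesis
    unfolding bounded_drift_def
  proof (intro exI[of _ "c + c'"] allI conjI)
    fix p :: int
    have eq: "h \<otimes> h' \<otimes> m [^] p = h \<otimes> (h' \<otimes> m [^] p)" using m h by (simp add: m_assoc)
    have "h \<otimes> m [^] (p - c') \<preceq> h \<otimes> (h' \<otimes> m [^] p)"
      by (rule mult_le[OF c'(1)]) (use m h in simp_all)
    then have "m [^] (p - c' - c) \<preceq> h \<otimes> (h' \<otimes> m [^] p)"
      by (rule le_trans[OF c(1)]) (use m h in simp_all)
    then show "m [^] (p - (c + c')) \<preceq> h \<otimes> h' \<otimes> m [^] p" unfolding eq by (simp add: algebra_simps)
    have "h \<otimes> (h' \<otimes> m [^] p) \<preceq> h \<otimes> m [^] (p + c')"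
      by (rule mult_le[OF c'(2)]) (use m h in simp_all)
    then have "h \<otimes> (h' \<otimes> m [^] p) \<preceq> m [^] (p + c' + c)"
      by (rule le_trans[OF _ c(2)]) (use m h in simp_all)
    then show "h \<otimes> h' \<otimes> m [^] p \<preceq> m [^] (p + (c + c'))" unfolding eq by (simp add: algebra_simps)
  qed
qed

lemma bounded_drift_inv:
  assumes m: "m \<in> carrier G" "\<one> \<prec> m" and h: "h \<in> carrier G" and "bounded_drift m h"
  shows "bounded_drift m (inv h)"
proof -
  obtain c :: int where c: "\<And>p. m [^] (p - c) \<preceq> h \<otimes> m [^] p" "\<And>p. h \<otimes> m [^] p \<preceq> m [^] (p + c)"
    using assms(4) unfolding bounded_drift_def by blast
  show ?thesis
    unfolding bounded_drift_def
  proof (intro exI[of _ c] allI conjI)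
    fix p :: int
    have "inv h \<otimes> (h \<otimes> m [^] (p - c)) \<preceq> inv h \<otimes> m [^] p"
      by (rule mult_le) (use c(2)[of "p - c"] m h in simp_all)
    then show "m [^] (p - c) \<preceq> inv h \<otimes> m [^] p" using m h by (simp add: mult_inv_cancel)
    have "inv h \<otimes> m [^] p \<preceq> inv h \<otimes> (h \<otimes> m [^] (p + c))"
      by (rule mult_le) (use c(1)[of "p + c"] m h in simp_all)
    then show "inv h \<otimes> m [^] p \<preceq> m [^] (p + c)" using m h by (simp add: mult_inv_cancel)
  qed
qed

text \<open>The integer part of \<open>x\<close> on the scale of the powers of \<open>m\<close>. The
  choice is arbitrary when \<open>x\<close> lies between no two consecutive powers; bounded drift of
  \<open>x\<close> excludes this.\<close>

definition power_floor :: "'a \<Rightarrow> 'a \<Rightarrow> int"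
  where "power_floor m x = (SOME p. m [^] p \<preceq> x \<and> x \<prec> m [^] (p + 1))"

lemma power_floor:
  assumes m: "m \<in> carrier G" "\<one> \<prec> m" and x: "x \<in> carrier G" and "bounded_drift m x"
  shows "m [^] power_floor m x \<preceq> x" "x \<prec> m [^] (power_floor m x + 1)"
proof -
  obtain c :: int where c: "\<And>p. m [^] (p - c) \<preceq> x \<otimes> m [^] p" "\<And>p. x \<otimes> m [^] p \<preceq> m [^] (p + c)"
    using assms(4) unfolding bounded_drift_def by blast
  have lower: "m [^] (- c) \<preceq> x" and upper: "x \<preceq> m [^] c"
    using c[of 0] x by simp_all
  \<comment> \<open>Exponents are counted from \<open>-c\<close> upward so that a least natural
    number can be taken. At \<open>2 * \<bar>c\<bar> + 1\<close> the exponent exceeds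
    \<open>c\<close>, so the search succeeds.\<close>
  let ?P = "\<lambda>n. x \<prec> m [^] (int n - c)"
  have "x \<prec> m [^] (int (nat (2 * \<bar>c\<bar> + 1)) - c)"
    by (rule le_less_trans[OF upper int_power_less]) (use m x in simp_all)
  moreover have "\<not> ?P 0" using lower m x not_less_iff by simp
  ultimately obtain k where k: "\<not> ?P k" "?P (Suc k)"
    using ex_least_nat_less[of ?P "nat (2 * \<bar>c\<bar> + 1)"] by blast
  have "m [^] (int k - c) \<preceq> x" using k(1) m x not_less_iff by simp
  moreover have "x \<prec> m [^] (int k - c + 1)" using k(2) by (simp add: algebra_simps)
  ultimately have "m [^] (int k - c) \<preceq> x \<and> x \<prec> m [^] (int k - c + 1)" ..
  then have "m [^] power_floor m x \<preceq> x \<and> x \<prec> m [^] (power_floor m x + 1)"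
    unfolding power_floor_def by (rule someI)
  then show "m [^] power_floor m x \<preceq> x" "x \<prec> m [^] (power_floor m x + 1)" by simp_all
qed

lemma power_floor_bounds:
  assumes m: "m \<in> carrier G" "\<one> \<prec> m" and x: "x \<in> carrier G" "bounded_drift m x"
    and "m [^] i \<preceq> x" "x \<prec> m [^] j"
  shows "i \<le> power_floor m x" "power_floor m x < j"
proof -
  have "m [^] i \<prec> m [^] (power_floor m x + 1)"
    by (rule le_less_trans[OF assms(5) power_floor(2)[OF m x]]) (use m x in simp_all)
  from int_power_less_cancel[OF m this] show "i \<le> power_floor m x" by simp
  have "m [^] power_floor m x \<prec> m [^] j"
    by (rule le_less_trans[OF power_floor(1)[OF m x] assms(6)]) (use m x in simp_all)
  from int_power_less_cancel[OF m this] show "power_floor m x < j" .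
qed

lemma power_floor_drift:
  assumes m: "m \<in> carrier G" "\<one> \<prec> m" and h: "h \<in> carrier G" "bounded_drift m h"
  shows "\<exists>c. \<forall>x\<in>carrier G. bounded_drift m x \<longrightarrow> \<bar>power_floor m (h \<otimes> x) - power_floor m x\<bar> \<le> c"
proof -
  obtain c :: int where c: "\<And>p. m [^] (p - c) \<preceq> h \<otimes> m [^] p" "\<And>p. h \<otimes> m [^] p \<preceq> m [^] (p + c)"
    using h(2) unfolding bounded_drift_def by blast
  show ?thesis
  proof (intro exI[of _ c] ballI impI)
    fix x assume x: "x \<in> carrier G" "bounded_drift m x"
    let ?p = "power_floor m x"
    note p = power_floor[OF m x]
    have hx: "h \<otimes> x \<in> carrier G" "bounded_drift m (h \<otimes> x)"
      using bounded_drift_mult[OF m h(1) x(1) h(2) x(2)] h x by simp_all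
    have "h \<otimes> m [^] ?p \<preceq> h \<otimes> x" by (rule mult_le[OF p(1)]) (use m h x in simp_all)
    then have lower: "m [^] (?p - c) \<preceq> h \<otimes> x" by (rule le_trans[OF c(1)]) (use m h x in simp_all)
    have "h \<otimes> x \<prec> h \<otimes> m [^] (?p + 1)" by (rule mult_less[OF p(2)]) (use m h x in simp_all)
    then have upper: "h \<otimes> x \<prec> m [^] (?p + 1 + c)"
      by (rule less_le_trans[OF _ c(2)]) (use m h x in simp_all)
    from power_floor_bounds[OF m hx lower upper] show "\<bar>power_floor m (h \<otimes> x) - ?p\<bar> \<le> c" by linarith
  qed
qed

text \<open>This exact shift makes the averaged displacement of \<open>m\<close> equal to 1, so the
  resulting character is nonzero.\<close>

lemma power_floor_mult:
  assumes m: "m \<in> carrier G" "\<one> \<prec> m" and x: "x \<in> carrier G" "bounded_drift m x"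
  shows "power_floor m (m \<otimes> x) = power_floor m x + 1"
proof -
  let ?p = "power_floor m x"
  note p = power_floor[OF m x]
  have mx: "m \<otimes> x \<in> carrier G" "bounded_drift m (m \<otimes> x)"
    using bounded_drift_mult[OF m m(1) x(1) bounded_drift_below[OF m m le_refl] x(2)] m x by simp_all
  have shift: "m \<otimes> m [^] q = m [^] (q + 1)" for q :: int
    using int_pow_mult[OF m(1), of 1 q] m(1) by (simp add: add.commute)
  have lower: "m [^] (?p + 1) \<preceq> m \<otimes> x"
    unfolding shift[symmetric] by (rule mult_le[OF p(1)]) (use m x in simp_all)
  have upper: "m \<otimes> x \<prec> m [^] (?p + 1 + 1)"
    unfolding shift[symmetric, of "?p + 1"] by (rule mult_less[OF p(2)]) (use m x in simp_all)
  from power_floor_bounds[OF m mx lower upper] show ?thesis by simp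
qed

text \<open>The character is the averaged displacement of the integer part relative to
  \<open>m\<close>. Every element of the generated subgroup has bounded drift, because the
  generators and their inverses do and bounded drift is closed under products.\<close>

lemma real_character_exists:
  assumes mean: "mean_group G \<mu>"
    and S: "finite S" "S \<subseteq> carrier G" "\<not> S \<subseteq> {\<one>}"
  shows "\<exists>(\<phi> :: 'a \<Rightarrow> real) m. m \<in> generate G S \<and> \<phi> m \<noteq> 0 \<and>
           (\<forall>h\<in>generate G S. \<forall>h'\<in>generate G S. \<phi> (h \<otimes> h') = \<phi> h + \<phi> h')"
proof -
  interpret mean_group G \<mu> by (rule mean)
  let ?H = "generate G S"
  have H: "subgroup ?H G" using S(2) by (rule generate_is_subgroup)
  then have Hc: "h \<in> carrier G" if "h \<in> ?H" for h using that by (rule subgroup.mem_carrier)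
  \<comment> \<open>Of each nontrivial generator and its inverse, one lies above the identity.
    Taking \<open>m\<close> greatest among these puts all of them in the range of
    \<open>bounded_drift_below\<close>.\<close>
  define P where "P = {x \<in> S \<union> m_inv G ` S. \<one> \<prec> x}"
  have inv_pos: "\<one> \<prec> inv s" if "s \<in> S" "s \<noteq> \<one>" "\<not> \<one> \<prec> s" for s
  proof -
    have s: "s \<in> carrier G" using S(2) that(1) by blast
    then have "s \<prec> \<one>" using less_total[of s \<one>] that by simp
    from mult_less[OF this s one_closed, of "inv s"] s show ?thesis by simp
  qed
  obtain s where s: "s \<in> S" "s \<noteq> \<one>" using S(3) by blast
  have P: "finite P" "P \<noteq> {}" using S(1) inv_pos[OF s] s by (auto simp: P_def)
  have Pc: "P \<subseteq> carrier G" using S(2) by (auto simp: P_def)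
  obtain m where m: "m \<in> P" and max: "\<And>a. a \<in> P \<Longrightarrow> a \<preceq> m"
    using finite_has_greatest[OF P Pc] by (elim bexE) simp
  have mc: "m \<in> carrier G" "\<one> \<prec> m" using m Pc by (auto simp: P_def)
  have mH: "m \<in> ?H" using m by (auto simp: P_def intro: generate.incl generate.inv)
  have pos: "bounded_drift m a" if "a \<in> P" for a
    using bounded_drift_below[OF mc _ _ max[OF that]] that Pc by (auto simp: P_def)
  have gen: "bounded_drift m a \<and> bounded_drift m (inv a)" if a: "a \<in> S" for a
  proof -
    have ac: "a \<in> carrier G" using S(2) a by blast
    consider "a = \<one>" | "a \<in> P" | "inv a \<in> P"
      using inv_pos[OF a] a by (auto simp: P_def)
    then show ?thesis
    proof cases
      case 1
      then show ?thesis using bounded_drift_one[OF mc(1)] by simp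
    next
      case 2
      then show ?thesis using pos bounded_drift_inv[OF mc ac] by blast
    next
      case 3
      then show ?thesis using pos[OF 3] bounded_drift_inv[OF mc inv_closed[OF ac]] ac by simp
    qed
  qed
  have drift: "bounded_drift m h" if "h \<in> ?H" for h
    using that
  proof (induction rule: generate.induct)
    case one
    show ?case by (rule bounded_drift_one[OF mc(1)])
  next
    case (eng h1 h2)
    then show ?case by (intro bounded_drift_mult[OF mc Hc Hc])
  qed (simp_all add: gen)
  have bounded: "\<exists>c. \<forall>x\<in>?H. \<bar>power_floor m (h \<otimes> x) - power_floor m x\<bar> \<le> c" if "h \<in> ?H" for h
    using power_floor_drift[OF mc Hc[OF that] drift[OF that]] Hc drift by (elim ex_forward) simp
  have "\<exists>\<phi> :: 'a \<Rightarrow> real. (\<forall>h\<in>?H. \<forall>h'\<in>?H. \<phi> (h \<otimes> h') = \<phi> h + \<phi> h') \<and>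
      (\<forall>h\<in>?H. \<forall>k. (\<forall>x\<in>?H. power_floor m (h \<otimes> x) = power_floor m x + k) \<longrightarrow> \<phi> h = of_int k)"
    using H bounded by (rule average_displacement_hom)
  then obtain \<phi> :: "'a \<Rightarrow> real"
    where \<phi>: "\<forall>h\<in>?H. \<forall>h'\<in>?H. \<phi> (h \<otimes> h') = \<phi> h + \<phi> h'"
      and shift: "\<forall>h\<in>?H. \<forall>k. (\<forall>x\<in>?H. power_floor m (h \<otimes> x) = power_floor m x + k) \<longrightarrow> \<phi> h = of_int k"
    by (elim exE conjE)
  have "\<phi> m = of_int 1"
    by (rule shift[rule_format, OF mH]) (simp add: power_floor_mult[OF mc] Hc drift)
  then show ?thesis using \<phi> mH by (intro exI[of _ \<phi>] exI[of _ m]) simp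
qed

end

section \<open>Infinite cyclic quotients\<close>

text \<open>A real character of a finitely generated group may have a noncyclic image. A
  rational-linear functional on the reals, obtained by extending the independent set
  \<open>{x}\<close> to a basis, makes its values rational and keeps a chosen one nonzero.\<close>

lemma rational_functional_exists:
  fixes x :: real
  assumes "x \<noteq> 0"
  shows "\<exists>l :: real \<Rightarrow> rat. (\<forall>a b. l (a + b) = l a + l b) \<and> l x \<noteq> 0"
proof -
  interpret vector_space_pair "\<lambda>(q::rat) (a::real). of_rat q * a" "(*) :: rat \<Rightarrow> rat \<Rightarrow> rat"
    by unfold_locales (simp_all add: algebra_simps of_rat_add of_rat_mult)
  have "vs1.independent {x}" using assms by (simp add: vs1.dependent_single)
  from linear_independent_extend[OF this, of "\<lambda>_. 1"] obtain l
    where lin: "Vector_Spaces.linear (\<lambda>(q::rat) (a::real). of_rat q * a) (*) l" and "l x = 1"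
    by auto
  have "l (a + b) = l a + l b" for a b by (rule linear_add[OF lin])
  with \<open>l x = 1\<close> show ?thesis by (intro exI[of _ l]) simp
qed

lemma common_denominator:
  assumes "finite (A :: rat set)"
  shows "\<exists>d::int. 0 < d \<and> (\<forall>a\<in>A. of_int d * a \<in> \<int>)"
  using assms
proof (induction rule: finite_induct)
  case (insert a A)
  then obtain d :: int where d: "0 < d" "\<And>b. b \<in> A \<Longrightarrow> of_int d * b \<in> \<int>" by blast
  obtain n e where e: "quotient_of a = (n, e)" by (cases "quotient_of a")
  have e0: "0 < e" using quotient_of_denom_pos[OF e] .
  have "of_int e * a = (of_int n :: rat)" using quotient_of_div[OF e] e0 by simp
  then have "of_int (d * e) * a = (of_int (d * n) :: rat)" by (simp add: mult.assoc)
  moreover have "of_int (d * e) * b \<in> \<int>" if "b \<in> A" for b :: rat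
  proof -
    have "of_int (d * e) * b = of_int e * (of_int d * b)" by simp
    then show ?thesis using d(2)[OF that] by (metis Ints_mult Ints_of_int)
  qed
  ultimately show ?case using d(1) e0 by (intro exI[of _ "d * e"]) (auto simp del: of_int_mult)
qed (auto intro: exI[of _ 1])

text \<open>The values of \<open>\<chi>\<close> are the multiples of the least positive value
  \<open>d\<close>, so dividing by \<open>d\<close> gives a homomorphism onto the integers, whose
  kernel is the required \<open>N\<close>.\<close>

lemma infinite_cyclic_quotient:
  fixes K :: "('a, 'b) monoid_scheme" (structure)
  assumes "group K" and x: "x \<in> carrier K" "\<chi> x \<noteq> (0::int)"
    and hom: "\<And>g h. \<lbrakk>g \<in> carrier K; h \<in> carrier K\<rbrakk> \<Longrightarrow> \<chi> (g \<otimes> h) = \<chi> g + \<chi> h"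
  shows "\<exists>N. N \<lhd> K \<and> cyclic_group (K Mod N) \<and> infinite (carrier (K Mod N))"
proof -
  interpret K: group K by fact
  interpret \<chi>: group_hom K integer_group \<chi>
    using \<open>group K\<close> by (simp add: group_hom_def group_hom_axioms_def hom_def hom)
  let ?D = "\<lambda>d. 0 < d \<and> int d \<in> \<chi> ` carrier K"
  have "\<exists>d. ?D d"
  proof (cases "0 < \<chi> x")
    case True
    then show ?thesis using x(1) by (intro exI[of _ "nat (\<chi> x)"]) simp
  next
    case False
    have "- \<chi> x \<in> \<chi> ` carrier K"
      using imageI[of "inv x" "carrier K" \<chi>] \<chi>.hom_inv[OF x(1)] x(1) by simp
    then show ?thesis using False x(2) by (intro exI[of _ "nat (- \<chi> x)"]) simp
  qed
  then have D: "?D (LEAST d. ?D d)" by (rule LeastI_ex)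
  define d where "d = (LEAST d. ?D d)"
  obtain y where y: "y \<in> carrier K" "\<chi> y = int d" and "0 < d" using D unfolding d_def by auto
  have dvd: "int d dvd \<chi> h" if h: "h \<in> carrier K" for h
  proof -
    \<comment> \<open>Division with remainder carried out in \<open>K\<close>: \<open>\<chi>\<close>
      maps \<open>h y^(-q)\<close> to the remainder of \<open>\<chi> h\<close> modulo
      \<open>d\<close>, and a positive remainder would contradict the minimality of
      \<open>d\<close>.\<close>
    let ?q = "\<chi> h div int d"
    have zc: "h \<otimes> y [^] (- ?q) \<in> carrier K" using h y(1) by simp
    have "\<chi> (h \<otimes> y [^] (- ?q)) = \<chi> h + \<chi> (y [^] (- ?q))"
      by (rule hom) (use h y(1) in simp_all)
    also have "\<chi> (y [^] (- ?q)) = - ?q * int d"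
      unfolding \<chi>.hom_int_pow[OF y(1)] y(2) by (rule group_int_pow_integer_group)
    also have "\<chi> h + - ?q * int d = \<chi> h mod int d"
      using minus_div_mult_eq_mod[of "\<chi> h" "int d"] by linarith
    finally have z: "\<chi> h mod int d \<in> \<chi> ` carrier K" using zc by (rule image_eqI[OF sym])
    show ?thesis
    proof (rule ccontr)
      assume "\<not> int d dvd \<chi> h"
      then have pos: "0 < \<chi> h mod int d"
        using \<open>0 < d\<close> mod_eq_0_iff_dvd[of "\<chi> h" "int d"] pos_mod_sign[of "int d" "\<chi> h"] by linarith
      then have "?D (nat (\<chi> h mod int d))"
        using z by simp
      then have "d \<le> nat (\<chi> h mod int d)" unfolding d_def by (rule Least_le)
      moreover have "\<chi> h mod int d < int d" using \<open>0 < d\<close> by simp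
      ultimately show False using pos by linarith
    qed
  qed
  define \<psi> where "\<psi> h = \<chi> h div int d" for h
  interpret \<psi>: group_hom K integer_group \<psi>
    using \<open>group K\<close> dvd
    by (simp add: group_hom_def group_hom_axioms_def hom_def hom \<psi>_def div_plus_div_distrib_dvd_left)
  have "n \<in> \<psi> ` carrier K" for n
  proof
    show "n = \<psi> (y [^] n)" using y \<open>0 < d\<close> by (simp add: \<psi>_def \<chi>.hom_int_pow)
  qed (use y in simp)
  then have "\<psi> ` carrier K = carrier integer_group" by auto
  from \<psi>.FactGroup_iso_set[OF this]
  have iso: "K Mod kernel K integer_group \<psi> \<cong> integer_group" by (auto simp: is_iso_def)
  have "group (K Mod kernel K integer_group \<psi>)"
    by (rule normal.factorgroup_is_group[OF \<psi>.normal_kernel])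
  then have "cyclic_group (K Mod kernel K integer_group \<psi>)"
    using isomorphic_group_cyclicity[OF iso] by simp
  moreover have "infinite (carrier (K Mod kernel K integer_group \<psi>))"
  proof -
    obtain f where "bij_betw f (carrier (K Mod kernel K integer_group \<psi>)) (UNIV :: int set)"
      using iso by (auto simp: is_iso_def iso_def)
    then show ?thesis using bij_betw_finite infinite_UNIV_int by blast
  qed
  ultimately show ?thesis using \<psi>.normal_kernel by blast
qed

theorem theorem1p1:
  fixes G :: "('a, 'b) monoid_scheme"
  assumes "group G"
    and "amenable G"
    and "\<exists>r. locally_invariant_order G r"
  shows "left_orderable G \<and> locally_indicable G"
proof -
  interpret group G by fact
  obtain \<mu> where \<mu>: "mean_group G \<mu>" using amenable_mean[OF assms(1,2)] .
  have orderable: "left_orderable G"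
    using assms(3) left_orderable_of_locally_invariant[OF \<mu>] by (elim exE)
  then obtain r where "conradian G r"
    using conradian_order_exists[OF \<mu>] unfolding left_orderable_def by (elim exE conjE) blast
  then interpret conradian G r .
  have "locally_indicable G"
    unfolding locally_indicable_def
  proof (intro allI impI)
    fix S assume S: "finite S" "S \<subseteq> carrier G" and nt: "\<not> trivial_group (subgroup_generated G S)"
    let ?K = "subgroup_generated G S"
    have K: "carrier ?K = generate G S"
      using S(2) by (simp add: carrier_subgroup_generated Int_absorb1)
    have "\<not> S \<subseteq> {\<one>\<^bsub>G\<^esub>}"
    proof
      assume triv: "S \<subseteq> {\<one>\<^bsub>G\<^esub>}"
      have "h = \<one>\<^bsub>G\<^esub>" if "h \<in> generate G S" for h
        using that by (induction rule: generate.induct) (use triv in auto)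
      then have "carrier ?K = {\<one>\<^bsub>?K\<^esub>}" using K generate.one by auto
      then show False using nt by (simp add: trivial_group_def)
    qed
    from real_character_exists[OF \<mu> S this] obtain \<phi> :: "'a \<Rightarrow> real" and m
      where m: "m \<in> generate G S" "\<phi> m \<noteq> 0"
        and \<phi>: "\<And>h h'. \<lbrakk>h \<in> generate G S; h' \<in> generate G S\<rbrakk> \<Longrightarrow> \<phi> (h \<otimes>\<^bsub>G\<^esub> h') = \<phi> h + \<phi> h'"
      by blast
    from rational_functional_exists[OF m(2)] obtain l :: "real \<Rightarrow> rat"
      where l: "\<And>a b. l (a + b) = l a + l b" and lm: "l (\<phi> m) \<noteq> 0" by blast
    have "finite ((\<lambda>s. l (\<phi> s)) ` S)" using S(1) by simp
    from common_denominator[OF this] obtain d :: int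
      where d: "0 < d" "\<And>s. s \<in> S \<Longrightarrow> of_int d * l (\<phi> s) \<in> \<int>" by blast
    \<comment> \<open>It suffices to clear the denominators at the finitely many generators:
      additivity carries integrality to inverses and products, hence to the whole subgroup.\<close>
    define \<psi> where "\<psi> h = of_int d * l (\<phi> h)" for h
    have \<psi>: "\<psi> (h \<otimes>\<^bsub>G\<^esub> h') = \<psi> h + \<psi> h'" if "h \<in> generate G S" "h' \<in> generate G S" for h h'
      using that by (simp add: \<psi>_def \<phi> l distrib_left)
    have \<psi>_one: "\<psi> \<one>\<^bsub>G\<^esub> = 0" using \<psi>[of "\<one>\<^bsub>G\<^esub>" "\<one>\<^bsub>G\<^esub>"] generate.one[of G S] by simp
    have integral: "\<psi> h \<in> \<int>" if "h \<in> generate G S" for h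
      using that
    proof (induction rule: generate.induct)
      case (inv s)
      have "\<psi> (s \<otimes>\<^bsub>G\<^esub> inv\<^bsub>G\<^esub> s) = \<psi> s + \<psi> (inv\<^bsub>G\<^esub> s)"
        using inv by (intro \<psi> generate.incl generate.inv)
      moreover have "s \<otimes>\<^bsub>G\<^esub> inv\<^bsub>G\<^esub> s = \<one>\<^bsub>G\<^esub>" using inv S(2) by auto
      ultimately have "\<psi> (inv\<^bsub>G\<^esub> s) = - \<psi> s" using \<psi>_one by (simp add: eq_neg_iff_add_eq_0 add.commute)
      then show ?case using d(2)[OF inv] by (simp add: \<psi>_def)
    next
      case (eng h1 h2)
      then show ?case by (simp add: \<psi>)
    qed (use d \<psi>_one in \<open>simp_all add: \<psi>_def\<close>)
    \<comment> \<open>The floor loses nothing here; it only retypes the integer-valued rational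
      function \<open>\<psi>\<close> as a function to \<open>int\<close>.\<close>
    have "\<lfloor>\<psi> (h \<otimes>\<^bsub>G\<^esub> h')\<rfloor> = \<lfloor>\<psi> h\<rfloor> + \<lfloor>\<psi> h'\<rfloor>" if "h \<in> generate G S" "h' \<in> generate G S" for h h'
      using \<psi>[OF that] integral[OF that(1)] integral[OF that(2)] by (elim Ints_cases) simp
    moreover have "\<lfloor>\<psi> m\<rfloor> \<noteq> 0"
    proof -
      have "\<psi> m \<noteq> 0" using d(1) lm by (simp add: \<psi>_def)
      then show ?thesis using integral[OF m(1)] by (elim Ints_cases) simp
    qed
    ultimately show "\<exists>N. N \<lhd> ?K \<and> cyclic_group (?K Mod N) \<and> infinite (carrier (?K Mod N))"
      using m(1) by (intro infinite_cyclic_quotient[of ?K m "\<lambda>h. \<lfloor>\<psi> h\<rfloor>"]) (simp_all add: K)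
  qed
  with orderable show ?thesis ..
qed

end
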